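(* The group of collineations of the Okubic projective plane $\mathcal{O}P^2$ is (isomorphic to) $\mathrm{E}_{6(-26)}$.
   Context: The real Okubo algebra $\mathcal{O}$ is the 8-dimensional real vector space of $3\times 3$ complex Hermitian traceless matrices with bilinear product $x*y=\mu\,xy+\overline{\mu}\,yx-\frac13\mathrm{Tr}(xy)\,I$, where $\mu=\frac16(3+\mathrm{i}\sqrt3)$ and juxtaposition is the matrix product. The Okubic projective plane $\mathcal{O}P^2$ is, in affine coordinates, the plane whose points are the pairs $(x,y)\in\mathcal{O}^2$, the points at infinity $(s)$ for $s\in\mathcal{O}$, and $(\infty)$, and whose lines are $[s,t]=\{(x,s*x+t):x\in\mathcal{O}\}\cup\{(s)\}$ for $s,t\in\mathcal{O}$, $[c]=(\{c\}\times\mathcal{O})\cup\{(\infty)\}$ for $c\in\mathcal{O}$, and $[\infty]=\{(s):s\in\mathcal{O}\}\cup\{(\infty)\}$; incidence is membership. A collineation is a bijection of the set of points onto itself mapping lines to lines; collineations form a group under composition. $\mathrm{E}_{6(-26)}$ is the minimally non-compact real form of the exceptional Lie group $\mathrm{E}_6$ (with maximal compact subgroup $\mathrm{F}_{4(-52)}$), which is the collineation group of the octonionic projective plane. *)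

theory Defs
  imports "HOL-Analysis.Analysis" "HOL-Algebra.Bij"
begin

section \<open>The real Okubo algebra\<close>

definition okubo :: "(complex ^ 3 ^ 3) set" where
  "okubo = {A. (\<forall>i j. A $ i $ j = cnj (A $ j $ i)) \<and> trace A = 0}"

definition okubo_mu :: complex where
  "okubo_mu = (3 + \<i> * complex_of_real (sqrt 3)) / 6"

text \<open>Here \<open>mat c\<close> is the scalar matrix \<open>c I\<close>, so that \<open>mat c ** A\<close> is the scalar multiple \<open>c A\<close>.\<close>

definition okubo_mult :: "complex ^ 3 ^ 3 \<Rightarrow> complex ^ 3 ^ 3 \<Rightarrow> complex ^ 3 ^ 3"
    (infixl "\<star>" 70) where
  "x \<star> y = mat okubo_mu ** (x ** y) + mat (cnj okubo_mu) ** (y ** x) - mat (trace (x ** y) / 3)"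

lemma okubo_mu_sum: "okubo_mu + cnj okubo_mu = 1"
  by (auto simp: okubo_mu_def complex_eq_iff)

lemma okubo_mult_closed: "x \<in> okubo \<Longrightarrow> y \<in> okubo \<Longrightarrow> x \<star> y \<in> okubo"
proof -
  assume a: "x \<in> okubo" "y \<in> okubo"
  have sym: "cnj (A$i$j) = A$j$i" if "A \<in> okubo" for A i j
  proof -
    have "A$j$i = cnj (A$i$j)" using that unfolding okubo_def by blast
    then show ?thesis by (rule sym)
  qed
  note h = sym[OF a(1)] sym[OF a(2)]
  have mm: "(mat c ** A)$i$j = c * A$i$j" for c::complex and A::"complex^3^3" and i j
    by (simp add: matrix_matrix_mult_def mat_def if_distrib if_distribR sum.delta cong: if_cong)
  have c: "cnj ((y ** x)$i$j) = (x**y)$j$i" "cnj ((x ** y)$i$j) = (y**x)$j$i" for i j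
    by (simp_all add: matrix_matrix_mult_def h mult.commute)
  have t: "trace (y**x) = trace (x**y)" by (rule trace_mul_sym)
  have ct: "cnj (trace (x**y)) = trace (x**y)"
    unfolding t[symmetric] by (simp only: trace_def cnj_sum c t[unfolded trace_def])
  have mt: "(mat c :: complex^3^3)$i$j = (if i = j then c else 0)" for c i j
    by (simp add: mat_def)
  have ct3: "cnj (trace (x ** y) / 3) = trace (x ** y) / 3"
    by (simp only: complex_cnj_divide ct complex_cnj_numeral)
  have 1: "(x \<star> y)$i$j = cnj ((x \<star> y)$j$i)" for i j
    by (cases "i = j")
      (simp_all only: okubo_mult_def vector_add_component vector_minus_component mm mt
        complex_cnj_add complex_cnj_diff complex_cnj_mult complex_cnj_cnj complex_cnj_zero
        c ct3 if_True if_False simp_thms add.commute eq_commute[of j i])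
  have tc: "trace (mat c ** A) = c * trace A" for c :: complex and A :: "complex^3^3"
    by (simp only: trace_def mm sum_distrib_left)
  have "trace (mat (trace (x ** y) / 3) :: complex^3^3) = trace (x ** y)"
    by (simp only: trace_def mt if_True simp_thms sum_constant) simp
  then have "trace (x \<star> y) = okubo_mu * trace (x**y) + cnj okubo_mu * trace (y**x) - trace(x**y)"
    by (simp only: okubo_mult_def trace_add trace_sub tc)
  also have "\<dots> = (okubo_mu + cnj okubo_mu - 1) * trace (x**y)"
    by (simp only: t left_diff_distrib distrib_right mult_1)
  also have "\<dots> = 0" by (simp only: okubo_mu_sum diff_self mult_zero_left)
  finally show ?thesis using 1 unfolding okubo_def by blast
qed


section \<open>The Okubic projective plane and its collineations\<close>

datatype 'a plane_point = Affine 'a 'a | Slope 'a | Vertical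

type_synonym okubic_point = "(complex ^ 3 ^ 3) plane_point"

definition okubic_points :: "okubic_point set" where
  "okubic_points =
     {Affine x y | x y. x \<in> okubo \<and> y \<in> okubo} \<union> {Slope s | s. s \<in> okubo} \<union> {Vertical}"

definition slope_line :: "complex ^ 3 ^ 3 \<Rightarrow> complex ^ 3 ^ 3 \<Rightarrow> okubic_point set" where
  "slope_line s t = {Affine x (s \<star> x + t) | x. x \<in> okubo} \<union> {Slope s}"

definition vertical_line :: "complex ^ 3 ^ 3 \<Rightarrow> okubic_point set" where
  "vertical_line c = {Affine c y | y. y \<in> okubo} \<union> {Vertical}"

definition line_at_infinity :: "okubic_point set" where
  "line_at_infinity = {Slope s | s. s \<in> okubo} \<union> {Vertical}"

definition okubic_lines :: "okubic_point set set" where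
  "okubic_lines =
     {slope_line s t | s t. s \<in> okubo \<and> t \<in> okubo} \<union> {vertical_line c | c. c \<in> okubo}
       \<union> {line_at_infinity}"

definition collineations :: "'p set \<Rightarrow> 'p set set \<Rightarrow> ('p \<Rightarrow> 'p) set" where
  "collineations P L = {f \<in> Bij P. \<forall>l\<in>L. f ` l \<in> L}"

definition collineation_group :: "'p set \<Rightarrow> 'p set set \<Rightarrow> ('p \<Rightarrow> 'p) monoid" where
  "collineation_group P L = BijGroup P \<lparr>carrier := collineations P L\<rparr>"


section \<open>The octonions\<close>

text \<open>The octonion division algebra is obtained from the complex numbers by applying the
  Cayley-Dickson doubling \<open>(a, b) (c, d) = (a c - d\<^sup>* b, d a + b c\<^sup>*)\<close>,
  \<open>(a, b)\<^sup>* = (a\<^sup>*, - b)\<close> twice. Addition, real scalars and the norm are the library's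
  on product types; the square of that (Euclidean) norm is the octonionic norm form
  \<open>x x\<^sup>*\<close>.\<close>

type_synonym quaternion = "complex \<times> complex"
type_synonym octonion = "quaternion \<times> quaternion"

definition qconj :: "quaternion \<Rightarrow> quaternion" where
  "qconj x = (cnj (fst x), - snd x)"

definition qmult :: "quaternion \<Rightarrow> quaternion \<Rightarrow> quaternion" where
  "qmult x y = (fst x * fst y - cnj (snd y) * snd x, snd y * fst x + snd x * cnj (fst y))"

definition omult :: "octonion \<Rightarrow> octonion \<Rightarrow> octonion" where
  "omult x y =
     (qmult (fst x) (fst y) - qmult (qconj (snd y)) (snd x),
      qmult (snd y) (fst x) + qmult (snd x) (qconj (fst y)))"

definition ore :: "octonion \<Rightarrow> real" where
  "ore x = Re (fst (fst x))"


section \<open>The Lie group $E_{6(-26)}$\<close>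

text \<open>The tuple \<open>(a, b, c, x, y, z)\<close> stands for the Hermitian octonionic matrix with rows
  \<open>(a, z, y\<^sup>*)\<close>, \<open>(z\<^sup>*, b, x)\<close>, \<open>(y, x\<^sup>*, c)\<close>, an element of the 27-dimensional Albert
  algebra \<open>J\<close>, and \<open>albert_det\<close> is Freudenthal's determinant, the cubic norm of \<open>J\<close>.
  (The real part of a triple product of octonions does not depend on the bracketing.)\<close>

type_synonym albert = "real \<times> real \<times> real \<times> octonion \<times> octonion \<times> octonion"

definition albert_det :: "albert \<Rightarrow> real" where
  "albert_det = (\<lambda>(a, b, c, x, y, z).
     a * b * c - a * (norm x)\<^sup>2 - b * (norm y)\<^sup>2 - c * (norm z)\<^sup>2
       + 2 * ore (omult (omult x y) z))"

text \<open>\<open>E\<^sub>6\<^sub>(\<^sub>-\<^sub>2\<^sub>6\<^sub>)\<close> is the group of all real linear automorphisms of \<open>J\<close> preserving the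
  determinant. This closed subgroup of \<open>GL(J)\<close> is connected and simply connected, has trivial
  centre, and the stabiliser of the identity matrix in it is its maximal compact subgroup
  \<open>F\<^sub>4\<^sub>(\<^sub>-\<^sub>5\<^sub>2\<^sub>)\<close>; it is thus both the simply connected and the adjoint group of its type.\<close>

definition E6_minus26 :: "(albert \<Rightarrow> albert) monoid" where
  "E6_minus26 = BijGroup UNIV
     \<lparr>carrier := {g \<in> Bij UNIV. linear g \<and> (\<forall>X. albert_det (g X) = albert_det X)}\<rparr>"

lemma group_E6_minus26: "group E6_minus26"
proof -
  interpret B: group "BijGroup (UNIV :: albert set)" by (rule group_BijGroup)
  define Q where "Q = (\<lambda>g. linear g \<and> (\<forall>X. albert_det (g X) = albert_det X))"
  define H where "H = {g \<in> Bij UNIV. Q g}"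
  have Q_id: "Q (\<lambda>x. x)"
    unfolding Q_def by (intro conjI allI linear_ident refl)
  have Q_compose: "Q (compose UNIV g h)" if "Q g" "Q h" for g h
  proof -
    have "compose UNIV g h = g \<circ> h" by (simp add: compose_def o_def restrict_def)
    moreover have "linear (g \<circ> h)" using that unfolding Q_def by (blast intro: linear_compose)
    moreover have "albert_det ((g \<circ> h) X) = albert_det X" for X
      using that by (simp only: Q_def o_apply)
    ultimately show ?thesis by (simp only: Q_def simp_thms)
  qed
  have Q_inv: "Q (inv_into UNIV g)" if "Q g" and g: "bij g" for g
  proof -
    have "albert_det (g (inv_into UNIV g X)) = albert_det (inv_into UNIV g X)" for X
      using that(1) unfolding Q_def by blast
    then have "albert_det (inv_into UNIV g X) = albert_det X" for X
      by (simp only: surj_f_inv_f[OF bij_is_surj[OF g]])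
    moreover have "linear (inv_into UNIV g)"
      using that(1) bij_is_inj[OF g] unfolding Q_def by (blast intro: inj_linear_imp_inv_linear)
    ultimately show ?thesis unfolding Q_def by blast
  qed
  have inv: "inv\<^bsub>BijGroup UNIV\<^esub> g \<in> H" if "g \<in> H" for g
  proof -
    have b: "bij g" and gB: "g \<in> Bij UNIV" and "Q g" using that by (auto simp: H_def Bij_def)
    have k: "inv_into UNIV g \<in> Bij UNIV" using restrict_inv_into_Bij[OF gB] by (simp add: restrict_def)
    have "compose UNIV (inv_into UNIV g) g = (\<lambda>x. x)"
      using b by (simp add: compose_def bij_is_inj restrict_def)
    then have "inv\<^bsub>BijGroup UNIV\<^esub> g = inv_into UNIV g"
      using k gB by (intro B.inv_equality) (simp_all add: BijGroup_def restrict_def)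
    then show ?thesis using k Q_inv[OF \<open>Q g\<close> b] by (simp add: H_def)
  qed
  have "subgroup H (BijGroup UNIV)"
  proof (rule B.subgroupI)
    show "H \<subseteq> carrier (BijGroup UNIV)" by (auto simp: H_def BijGroup_def)
    show "H \<noteq> {}" using Q_id id_Bij[of UNIV] by (auto simp: H_def restrict_def)
    show "g \<otimes>\<^bsub>BijGroup UNIV\<^esub> h \<in> H" if "g \<in> H" "h \<in> H" for g h
      using that Q_compose by (simp add: H_def BijGroup_def compose_Bij)
  qed (rule inv)
  then have "group (BijGroup UNIV \<lparr>carrier := H\<rparr>)" by (rule B.subgroup_imp_group)
  then show ?thesis unfolding E6_minus26_def H_def Q_def .
qed

end

theory Submission
  imports Defs
begin

text \<open>With \<open>\<gamma>\<close> an isometry from the Okubo algebra onto the octonions there are linear bijections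
  \<open>\<alpha>\<close>, \<open>\<beta>\<close> with \<open>\<gamma> (s \<star> x) = \<alpha> s \<cdot> \<beta> x\<close>, so \<open>(x, y) \<mapsto> (\<beta> x, \<gamma> y)\<close>, \<open>(s) \<mapsto> (\<alpha> s)\<close> identifies the
  Okubic plane with the octonionic plane. The points of the latter are the classes of elements of
  rank one of the Albert algebra, where rank one means that the derivative of the determinant
  vanishes; hence a determinant-preserving linear map permutes the points. It is a collineation
  because collinearity is the vanishing of the polarised determinant: this can be checked after
  moving two of the points to the points at infinity \<open>(\<infinity>)\<close> and \<open>(0)\<close> by elementary collineations,
  which come from explicit determinant-preserving maps.

  Conversely, these elementary collineations reduce an arbitrary collineation to one fixing the
  triangle \<open>(\<infinity>)\<close>, \<open>(0)\<close>, \<open>(0, 0)\<close>. Such a collineation is an additive autotopism of the octonions. Since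
  the centre of the octonions is the real field, which has no automorphisms, the autotopism is
  real linear; since the norm is the only multiplicative norm, it consists of similarities, and
  therefore acts on the Albert algebra preserving the determinant up to a factor. Finally, only
  the identity preserves the determinant and fixes every point.\<close>

section \<open>Octonion arithmetic\<close>

definition oconj :: "octonion \<Rightarrow> octonion" where
  "oconj x = (qconj (fst x), - snd x)"

definition oone :: octonion where
  "oone = ((1, 0), (0, 0))"

lemmas octonion_defs = omult_def qmult_def qconj_def oconj_def oone_def ore_def

lemma octonion_eq_iff: "x = y \<longleftrightarrow>
   Re (fst (fst x)) = Re (fst (fst y)) \<and> Im (fst (fst x)) = Im (fst (fst y)) \<and>
   Re (snd (fst x)) = Re (snd (fst y)) \<and> Im (snd (fst x)) = Im (snd (fst y)) \<and>
   Re (fst (snd x)) = Re (fst (snd y)) \<and> Im (fst (snd x)) = Im (fst (snd y)) \<and>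
   Re (snd (snd x)) = Re (snd (snd y)) \<and> Im (snd (snd x)) = Im (snd (snd y))"
  for x y :: octonion
  by (auto simp: prod_eq_iff complex_eq_iff)

lemma octonion_inner: "x \<bullet> y =
   Re (fst (fst x)) * Re (fst (fst y)) + Im (fst (fst x)) * Im (fst (fst y)) +
   Re (snd (fst x)) * Re (snd (fst y)) + Im (snd (fst x)) * Im (snd (fst y)) +
   Re (fst (snd x)) * Re (fst (snd y)) + Im (fst (snd x)) * Im (fst (snd y)) +
   Re (snd (snd x)) * Re (snd (snd y)) + Im (snd (snd x)) * Im (snd (snd y))"
  for x y :: octonion
  by (simp add: inner_prod_def inner_complex_def)

lemma bilinear_omult: "bilinear omult"
  unfolding bilinear_def
  by (intro conjI allI linearI; simp add: octonion_eq_iff octonion_defs algebra_simps)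

interpretation omult: bounded_bilinear omult
  using bilinear_omult by (simp add: bilinear_conv_bounded_bilinear)

lemma linear_oconj: "linear oconj"
  by (rule linearI; simp add: octonion_eq_iff octonion_defs algebra_simps)

lemmas oconj_simps = linear_add[OF linear_oconj] linear_diff[OF linear_oconj]
  linear_neg[OF linear_oconj] linear_scale[OF linear_oconj] linear_0[OF linear_oconj]

lemma oconj_oconj [simp]: "oconj (oconj x) = x"
  by (simp add: octonion_eq_iff octonion_defs)

lemma inner_oconj [simp]: "oconj x \<bullet> oconj y = x \<bullet> y"
  by (simp add: octonion_inner octonion_defs)

lemma inner_oconj_left: "oconj x \<bullet> y = x \<bullet> oconj y"
  by (simp add: octonion_inner octonion_defs)

lemma norm_oconj [simp]: "norm (oconj x) = norm x"
  by (simp add: norm_eq_sqrt_inner)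

lemma oconj_eq_0_iff [simp]: "oconj x = 0 \<longleftrightarrow> x = 0"
  by (metis norm_oconj norm_eq_zero)

lemma oconj_omult: "oconj (omult x y) = omult (oconj y) (oconj x)"
  by (simp add: octonion_eq_iff octonion_defs algebra_simps)

lemma omult_oone [simp]: "omult x oone = x" "omult oone x = x"
  by (simp_all add: octonion_eq_iff octonion_defs)

lemma ore_omult: "ore (omult x y) = x \<bullet> oconj y"
  by (simp add: octonion_inner octonion_defs algebra_simps)

text \<open>Adjointness, together with the cancellation law after it, stands in for associativity in
  the later computations. Both are polynomial identities in the eight real coordinates.\<close>

lemma inner_omult_swap_left: "omult x y \<bullet> z = y \<bullet> omult (oconj x) z"
  by (simp add: octonion_inner octonion_defs algebra_simps)

lemma omult_oconj_cancel_left: "omult (oconj x) (omult x y) = (norm x)\<^sup>2 *\<^sub>R y"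
  unfolding power2_norm_eq_inner octonion_inner
  by (simp add: octonion_eq_iff octonion_defs algebra_simps)

lemma inner_omult_swap_right: "omult x y \<bullet> z = x \<bullet> omult z (oconj y)"
  by (metis inner_oconj inner_omult_swap_left oconj_oconj oconj_omult)

lemma omult_oconj_cancel_right: "omult (omult x y) (oconj y) = (norm y)\<^sup>2 *\<^sub>R x"
  by (metis oconj_omult oconj_oconj omult_oconj_cancel_left norm_oconj linear_scale[OF linear_oconj])

text \<open>Moving the left factor across the inner product turns the squared norm of
  \<open>omult x y\<close> into the inner product of \<open>y\<close> with
  \<open>omult (oconj x) (omult x y)\<close>, where the conjugate cancels.\<close>

lemma norm_omult: "norm (omult x y) = norm x * norm y"
proof -
  have "(norm (omult x y))\<^sup>2 = (norm x * norm y)\<^sup>2"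
    by (simp only: power2_norm_eq_inner inner_omult_swap_left omult_oconj_cancel_left)
      (simp add: power_mult_distrib power2_norm_eq_inner inner_commute)
  then show ?thesis by (simp add: power2_eq_iff_nonneg)
qed

lemma omult_eq_0_iff [simp]: "omult x y = 0 \<longleftrightarrow> x = 0 \<or> y = 0"
  by (metis norm_omult norm_eq_zero mult_eq_0_iff)

lemma omult_0 [simp]: "omult 0 x = 0" "omult x 0 = 0"
  by (rule omult.zero_left omult.zero_right)+

lemma oone_neq_0 [simp]: "oone \<noteq> 0"
  by (simp add: oone_def zero_prod_def)

lemma norm_oone [simp]: "norm oone = 1"
  by (simp add: norm_eq_sqrt_inner octonion_inner oone_def)

text \<open>The convention for division by zero gives \<open>oinv 0 = 0\<close>, so
  \<open>oinv\<close> is an involution on all octonions.\<close>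

definition oinv :: "octonion \<Rightarrow> octonion" where
  "oinv x = oconj x /\<^sub>R (norm x)\<^sup>2"

lemma oinv_cancel:
  assumes "y \<noteq> 0"
  shows "omult (omult x y) (oinv y) = x" "omult (omult x (oinv y)) y = x"
    "omult (oinv y) (omult y x) = x" "omult y (omult (oinv y) x) = x"
  using assms omult_oconj_cancel_right[of x y] omult_oconj_cancel_right[of x "oconj y"]
    omult_oconj_cancel_left[of y x] omult_oconj_cancel_left[of "oconj y" x]
  by (simp_all add: oinv_def omult.scaleR_left omult.scaleR_right)

lemma norm_oinv: "norm (oinv x) = inverse (norm x)"
  by (cases "x = 0") (simp_all add: oinv_def power2_eq_square)

lemma oinv_eq_0_iff [simp]: "oinv x = 0 \<longleftrightarrow> x = 0"
  by (simp add: oinv_def)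

lemma oinv_oinv [simp]: "oinv (oinv x) = x"
  by (cases "x = 0") (simp_all add: oinv_def oconj_simps power2_eq_square field_simps)

lemma omult_oinv: "x \<noteq> 0 \<Longrightarrow> omult x (oinv x) = oone" "x \<noteq> 0 \<Longrightarrow> omult (oinv x) x = oone"
  using oinv_cancel[of x oone] by simp_all

lemma omult_right_cancel: "y \<noteq> 0 \<Longrightarrow> omult x y = omult x' y \<longleftrightarrow> x = x'"
  by (metis oinv_cancel(1))

section \<open>The octonionic plane\<close>

definition oline :: "octonion \<Rightarrow> octonion \<Rightarrow> octonion plane_point set" where
  "oline s t = range (\<lambda>x. Affine x (omult s x + t)) \<union> {Slope s}"

definition vline :: "octonion \<Rightarrow> octonion plane_point set" where
  "vline c = range (Affine c) \<union> {Vertical}"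

definition iline :: "octonion plane_point set" where
  "iline = range Slope \<union> {Vertical}"

definition olines :: "octonion plane_point set set" where
  "olines = {oline s t | s t. True} \<union> range vline \<union> {iline}"

lemma oline_iff [simp]:
  "Affine p q \<in> oline s t \<longleftrightarrow> q = omult s p + t"
  "Slope m \<in> oline s t \<longleftrightarrow> m = s" "Vertical \<notin> oline s t"
  by (auto simp: oline_def)

lemma vline_iff [simp]:
  "Affine p q \<in> vline c \<longleftrightarrow> p = c" "Slope m \<notin> vline c" "Vertical \<in> vline c"
  by (auto simp: vline_def)

lemma iline_iff [simp]: "Affine p q \<notin> iline" "Slope m \<in> iline" "Vertical \<in> iline"
  by (auto simp: iline_def)

lemma olinesI [intro]: "oline s t \<in> olines" "vline c \<in> olines" "iline \<in> olines"
  unfolding olines_def by blast+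

lemma olinesE:
  assumes "l \<in> olines"
  obtains s t where "l = oline s t" | c where "l = vline c" | "l = iline"
  using assms unfolding olines_def by blast

lemma plane_set_eqI:
  assumes "\<And>p q. Affine p q \<in> S \<longleftrightarrow> Affine p q \<in> T" "\<And>s. Slope s \<in> S \<longleftrightarrow> Slope s \<in> T"
    "Vertical \<in> S \<longleftrightarrow> Vertical \<in> T"
  shows "S = T"
proof (rule Set.set_eqI)
  fix x show "x \<in> S \<longleftrightarrow> x \<in> T" using assms by (cases x) auto
qed

text \<open>The equivalence makes preimages of lines lines as well, whereas
  \<open>collineations\<close> speaks of images only.\<close>

definition line_preserving :: "(octonion plane_point \<Rightarrow> octonion plane_point) \<Rightarrow> bool" where
  "line_preserving f \<longleftrightarrow> bij f \<and> (\<forall>l. f ` l \<in> olines \<longleftrightarrow> l \<in> olines)"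

text \<open>Preimages are convenient because substitution into the equation of a line computes them
  directly.\<close>

lemma line_preservingI:
  assumes "\<And>x. f (f' x) = x" "\<And>x. f' (f x) = x"
    and "\<And>l. l \<in> olines \<Longrightarrow> {x. f x \<in> l} \<in> olines" "\<And>l. l \<in> olines \<Longrightarrow> {x. f' x \<in> l} \<in> olines"
  shows "line_preserving f"
proof -
  have "bij f" using assms(1,2) by (metis bijI')
  moreover have 1: "f ` l = {x. f' x \<in> l}" for l
    using assms(1,2) by (auto simp: image_iff) metis
  have "{x. f x \<in> f ` l} = l" for l using \<open>bij f\<close> by (auto simp: bij_def inj_image_mem_iff)
  then have "f ` l \<in> olines \<longleftrightarrow> l \<in> olines" for l
    using assms(3)[of "f ` l"] assms(4)[of l] by (auto simp: 1)
  ultimately show ?thesis by (simp add: line_preserving_def)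
qed

lemma line_preserving_involution:
  assumes "\<And>x. f (f x) = x" "\<And>l. l \<in> olines \<Longrightarrow> {x. f x \<in> l} \<in> olines"
  shows "line_preserving f"
  using assms by (intro line_preservingI[of f f])

lemma line_preserving_o: "line_preserving f \<Longrightarrow> line_preserving h \<Longrightarrow> line_preserving (f \<circ> h)"
proof -
  have "(f \<circ> h) ` l = f ` h ` l" for l by (simp only: image_comp)
  then show "line_preserving f \<Longrightarrow> line_preserving h \<Longrightarrow> line_preserving (f \<circ> h)"
    by (simp add: line_preserving_def bij_comp)
qed

section \<open>Elementary collineations\<close>

fun translate :: "octonion \<Rightarrow> octonion plane_point \<Rightarrow> octonion plane_point" where
  "translate b (Affine p q) = Affine p (q + b)"
| "translate b (Slope s) = Slope s"
| "translate b Vertical = Vertical"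

text \<open>Reflection in the diagonal inverts slopes. The case split is due to
  \<open>oinv 0 = 0\<close>: slope zero must go to \<open>Vertical\<close> instead.\<close>

fun swap_xy :: "octonion plane_point \<Rightarrow> octonion plane_point" where
  "swap_xy (Affine p q) = Affine q p"
| "swap_xy (Slope s) = (if s = 0 then Vertical else Slope (oinv s))"
| "swap_xy Vertical = Slope 0"

text \<open>In homogeneous coordinates (q, p, 1) this exchanges p and 1 and normalises again. The
  affine points with p = 0 trade places with the slopes.\<close>

fun swap_x1 :: "octonion plane_point \<Rightarrow> octonion plane_point" where
  "swap_x1 (Affine p q) = (if p = 0 then Slope q else Affine (oinv p) (omult q (oinv p)))"
| "swap_x1 (Slope s) = Affine 0 s"
| "swap_x1 Vertical = Vertical"

lemma line_preserving_translate: "line_preserving (translate b)"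
proof (rule line_preservingI[where f' = "translate (- b)"])
  show "translate b (translate (- b) x) = x" "translate (- b) (translate b x) = x" for x
    by (cases x; simp)+
  have "{x. translate b x \<in> l} \<in> olines" if "l \<in> olines" for l b
    using that
  proof (cases rule: olinesE)
    case (1 s t)
    have "{x. translate b x \<in> l} = oline s (t - b)"
      by (rule plane_set_eqI) (auto simp: 1 algebra_simps)
    then show ?thesis by auto
  next
    case (2 c)
    have "{x. translate b x \<in> l} = l" by (rule plane_set_eqI) (auto simp: 2)
    then show ?thesis using that by auto
  next
    case 3
    have "{x. translate b x \<in> l} = l" by (rule plane_set_eqI) (auto simp: 3)
    then show ?thesis using that by auto
  qed
  then show "{x. translate b x \<in> l} \<in> olines" "{x. translate (- b) x \<in> l} \<in> olines"
    if "l \<in> olines" for l using that by blast+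
qed

lemma line_preserving_swap_xy: "line_preserving swap_xy"
proof (rule line_preserving_involution)
  show "swap_xy (swap_xy x) = x" for x
    by (cases x) simp_all
  show "{x. swap_xy x \<in> l} \<in> olines" if "l \<in> olines" for l
    using that
  proof (cases rule: olinesE)
    case (1 s t)
    show ?thesis
    proof (cases "s = 0")
      case True
      have "{x. swap_xy x \<in> l} = vline t" by (rule plane_set_eqI) (auto simp: 1 True)
      then show ?thesis by auto
    next
      case False
      have "p = omult s q + t \<longleftrightarrow> q = omult (oinv s) p - omult (oinv s) t" for p q
        by (metis False add_diff_cancel add_diff_cancel_right' diff_add_cancel oinv_cancel(3,4)
            omult.diff_right)
      then have "{x. swap_xy x \<in> l} = oline (oinv s) (- omult (oinv s) t)"
        by (intro plane_set_eqI) (auto simp: 1 False)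
      then show ?thesis by auto
    qed
  next
    case (2 c)
    have "{x. swap_xy x \<in> l} = oline 0 c" by (rule plane_set_eqI) (auto simp: 2)
    then show ?thesis by auto
  next
    case 3
    have "{x. swap_xy x \<in> l} = iline" by (rule plane_set_eqI) (auto simp: 3)
    then show ?thesis by auto
  qed
qed

lemma line_preserving_swap_x1: "line_preserving swap_x1"
proof (rule line_preserving_involution)
  show "swap_x1 (swap_x1 x) = x" for x
    by (cases x) (simp_all add: oinv_cancel)
  show "{x. swap_x1 x \<in> l} \<in> olines" if "l \<in> olines" for l
    using that
  proof (cases rule: olinesE)
    case (1 s t)
    have "omult q (oinv p) = omult s (oinv p) + t \<longleftrightarrow> q = omult t p + s" if "p \<noteq> 0" for p q
    proof -
      have "omult q (oinv p) = omult s (oinv p) + t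
          \<longleftrightarrow> omult (omult q (oinv p)) p = omult (omult s (oinv p) + t) p"
        using that by (simp add: omult_right_cancel)
      then show ?thesis using that by (simp add: oinv_cancel omult.add_left add.commute)
    qed
    then have "{x. swap_x1 x \<in> l} = oline t s" by (intro plane_set_eqI) (auto simp: 1)
    then show ?thesis by auto
  next
    case (2 c)
    show ?thesis
    proof (cases "c = 0")
      case True
      have "{x. swap_x1 x \<in> l} = iline" by (rule plane_set_eqI) (auto simp: 2 True)
      then show ?thesis by auto
    next
      case False
      have "oinv p = c \<longleftrightarrow> p = oinv c" for p by (metis oinv_oinv)
      then have "{x. swap_x1 x \<in> l} = vline (oinv c)"
        using False by (intro plane_set_eqI) (auto simp: 2)
      then show ?thesis by auto
    qed
  next
    case 3
    have "{x. swap_x1 x \<in> l} = vline 0" by (rule plane_set_eqI) (auto simp: 3)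
    then show ?thesis by auto
  qed
qed

section \<open>Veronese coordinates\<close>

text \<open>The Hermitian matrix v v^* for the homogeneous column v = (q, p, 1), (s, 1, 0) or (1, 0,
  0), whose last nonzero entry is normalised to 1.\<close>

fun veronese :: "octonion plane_point \<Rightarrow> albert" where
  "veronese (Affine p q) = ((norm q)\<^sup>2, (norm p)\<^sup>2, 1, p, oconj q, omult q (oconj p))"
| "veronese (Slope s) = ((norm s)\<^sup>2, 1, 0, 0, 0, s)"
| "veronese Vertical = (1, 0, 0, 0, 0, 0)"

declare split_paired_All [simp del] split_paired_Ex [simp del]

section \<open>Determinant-preserving maps and the point maps that they induce\<close>

definition e6 :: "(albert \<Rightarrow> albert) set" where
  "e6 = {g. bij g \<and> linear g \<and> (\<forall>X. albert_det (g X) = albert_det X)}"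

text \<open>The factor may depend on the point, since a Veronese vector represents its point only up
  to a nonzero real scalar.\<close>

definition induces :: "(albert \<Rightarrow> albert) \<Rightarrow> (octonion plane_point \<Rightarrow> octonion plane_point) \<Rightarrow> bool"
  where "induces g f \<longleftrightarrow> (\<forall>p. \<exists>k. k \<noteq> 0 \<and> g (veronese p) = k *\<^sub>R veronese (f p))"

lemma induces_o:
  assumes "induces g f" "induces g' f'" "linear g'"
  shows "induces (g' \<circ> g) (f' \<circ> f)"
  unfolding induces_def
proof
  fix p
  obtain k where "k \<noteq> 0" "g (veronese p) = k *\<^sub>R veronese (f p)"
    using assms(1) unfolding induces_def by blast
  moreover obtain k' where "k' \<noteq> 0" "g' (veronese (f p)) = k' *\<^sub>R veronese (f' (f p))"
    using assms(2) unfolding induces_def by blast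
  ultimately have "k * k' \<noteq> 0 \<and> (g' \<circ> g) (veronese p) = (k * k') *\<^sub>R veronese ((f' \<circ> f) p)"
    using linear_scale[OF assms(3)] by simp
  then show "\<exists>k. k \<noteq> 0 \<and> (g' \<circ> g) (veronese p) = k *\<^sub>R veronese ((f' \<circ> f) p)" by blast
qed

lemma e6_o: "g \<in> e6 \<Longrightarrow> h \<in> e6 \<Longrightarrow> g \<circ> h \<in> e6"
  unfolding e6_def by (simp add: bij_comp linear_compose)

lemma e6_inv:
  assumes "g \<in> e6" shows "inv_into UNIV g \<in> e6"
proof -
  have g: "bij g" "linear g" and d: "albert_det (g X) = albert_det X" for X
    using assms by (simp_all add: e6_def)
  have "albert_det (inv_into UNIV g X) = albert_det X" for X
    using d[of "inv_into UNIV g X"] g(1) by (simp add: bij_is_surj surj_f_inv_f)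
  then show ?thesis
    using g by (simp add: e6_def bij_imp_bij_inv inj_linear_imp_inv_linear bij_is_inj)
qed

text \<open>This is X \<mapsto> T X T^* for the elementary matrix T that adds u times row three to
  row one. The two maps below are conjugations by permutation matrices.\<close>

definition translate_map :: "octonion \<Rightarrow> albert \<Rightarrow> albert" where
  "translate_map u = (\<lambda>(a, b, c, x, y, z).
     (a + 2 * (y \<bullet> oconj u) + c * (norm u)\<^sup>2, b, c, x, y + c *\<^sub>R oconj u, z + omult u (oconj x)))"

definition swap_xy_map :: "albert \<Rightarrow> albert" where
  "swap_xy_map = (\<lambda>(a, b, c, x, y, z). (b, a, c, oconj y, oconj x, oconj z))"

definition swap_x1_map :: "albert \<Rightarrow> albert" where
  "swap_x1_map = (\<lambda>(a, b, c, x, y, z). (a, c, b, oconj x, oconj z, oconj y))"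

lemma albert_cases:
  fixes X :: albert
  obtains a b c x y z where "X = (a, b, c, x, y, z)"
  by (rule prod_cases6[of X])

lemma albert_linearI:
  assumes "\<And>a b c x y z a' b' c' x' y' z'. f (a + a', b + b', c + c', x + x', y + y', z + z') =
      f (a, b, c, x, y, z) + f (a', b', c', x', y', z')"
    and "\<And>r a b c x y z. f (r * a, r * b, r * c, r *\<^sub>R x, r *\<^sub>R y, r *\<^sub>R z) =
      r *\<^sub>R f (a, b, c, x, y, z)"
  shows "linear (f :: albert \<Rightarrow> albert)"
proof (rule linearI)
  fix X Y :: albert and r
  show "f (X + Y) = f X + f Y" by (cases X rule: albert_cases; cases Y rule: albert_cases) (simp add: assms(1))
  show "f (r *\<^sub>R X) = r *\<^sub>R f X" by (cases X rule: albert_cases) (simp add: assms(2))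
qed

lemma albert_det_inner:
  "albert_det (a, b, c, x, y, z) =
     a * b * c - a * (x \<bullet> x) - b * (y \<bullet> y) - c * (z \<bullet> z) + 2 * (omult x y \<bullet> oconj z)"
  by (simp add: albert_det_def ore_omult power2_norm_eq_inner)

lemma translate_map_e6: "translate_map u \<in> e6"
proof -
  have inverse: "translate_map u (translate_map (- u) X) = X" for u X
    by (cases X rule: albert_cases) (simp add: translate_map_def oconj_simps power2_norm_eq_inner inner_diff
        omult.minus_left algebra_simps)
  have "bij (translate_map u)"
    using inverse[of u] inverse[of "- u"] by (metis bijI' minus_minus)
  moreover have "linear (translate_map u)"
    by (rule albert_linearI) (simp_all add: translate_map_def oconj_simps inner_add omult.add_right
        omult.scaleR_right algebra_simps)
  moreover have "albert_det (translate_map u X) = albert_det X" for X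
  proof -
    obtain a b c x y z where X: "X = (a, b, c, x, y, z)" by (cases X rule: albert_cases)
    \<comment> \<open>These identities make the terms created by \<open>u\<close> cancel between the
      products with \<open>x \<bullet> x\<close>, the square of the new \<open>z\<close> and the
      triple product.\<close>
    have 1: "omult x y \<bullet> omult x (oconj u) = (x \<bullet> x) * (y \<bullet> oconj u)" for y
      by (simp add: inner_omult_swap_left[of x y] omult_oconj_cancel_left power2_norm_eq_inner)
    have 2: "oconj z \<bullet> omult x (oconj u) = z \<bullet> omult u (oconj x)"
      by (metis inner_commute inner_oconj oconj_oconj oconj_omult)
    have 3: "omult u (oconj x) \<bullet> omult u (oconj x) = (u \<bullet> u) * (x \<bullet> x)"
      by (simp add: norm_omult power_mult_distrib flip: power2_norm_eq_inner)
    show ?thesis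
      by (simp add: X translate_map_def albert_det_inner power2_norm_eq_inner oconj_simps oconj_omult
          omult.add_right omult.scaleR_right inner_add 1 2 3 algebra_simps inner_commute)
  qed
  ultimately show ?thesis by (simp add: e6_def)
qed

lemma swap_xy_map_e6: "swap_xy_map \<in> e6"
proof -
  have "swap_xy_map (swap_xy_map X) = X" for X by (cases X rule: albert_cases) (simp add: swap_xy_map_def)
  then have "bij swap_xy_map" by (metis bijI')
  moreover have "linear swap_xy_map"
    by (rule albert_linearI) (simp_all add: swap_xy_map_def oconj_simps)
  moreover have "omult (oconj y) (oconj x) \<bullet> z = omult x y \<bullet> oconj z" for x y z
    by (metis inner_oconj_left oconj_omult)
  then have "albert_det (swap_xy_map X) = albert_det X" for X
    by (cases X rule: albert_cases) (simp add: swap_xy_map_def albert_det_inner algebra_simps)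
  ultimately show ?thesis by (simp add: e6_def)
qed

lemma swap_x1_map_e6: "swap_x1_map \<in> e6"
proof -
  have "swap_x1_map (swap_x1_map X) = X" for X by (cases X rule: albert_cases) (simp add: swap_x1_map_def)
  then have "bij swap_x1_map" by (metis bijI')
  moreover have "linear swap_x1_map"
    by (rule albert_linearI) (simp_all add: swap_x1_map_def oconj_simps)
  moreover have "omult (oconj x) (oconj z) \<bullet> y = omult x y \<bullet> oconj z" for x y z
    by (metis inner_omult_swap_left inner_commute oconj_oconj)
  then have "albert_det (swap_x1_map X) = albert_det X" for X
    by (cases X rule: albert_cases) (simp add: swap_x1_map_def albert_det_inner algebra_simps)
  ultimately show ?thesis by (simp add: e6_def)
qed

lemma induces_translate: "induces (translate_map b) (translate b)"
  unfolding induces_def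
proof
  fix p
  have "translate_map b (veronese p) = 1 *\<^sub>R veronese (translate b p)"
    by (cases p) (simp_all add: translate_map_def oconj_simps omult.add_left power2_norm_eq_inner
      inner_add inner_commute)
  then show "\<exists>k. k \<noteq> 0 \<and> translate_map b (veronese p) = k *\<^sub>R veronese (translate b p)"
    by (metis zero_neq_one)
qed

lemma induces_swap_xy: "induces swap_xy_map swap_xy"
  unfolding induces_def
proof
  fix p
  show "\<exists>k. k \<noteq> 0 \<and> swap_xy_map (veronese p) = k *\<^sub>R veronese (swap_xy p)"
  proof (cases p)
    case (Slope s)
    show ?thesis
    proof (cases "s = 0")
      case True
      show ?thesis by (rule exI[of _ 1]) (simp add: Slope True swap_xy_map_def oconj_simps)
    next
      case False
      then have "(norm s)\<^sup>2 *\<^sub>R oinv s = oconj s" by (simp add: oinv_def)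
      \<comment> \<open>The column (1, s, 0) is (s^-1, 1, 0) multiplied by s, which scales v v^* by
        the squared norm of s.\<close>
      with False show ?thesis
        by (intro exI[of _ "(norm s)\<^sup>2"])
          (simp add: Slope swap_xy_map_def oconj_simps norm_oinv power_inverse)
    qed
  next
    case (Affine x y)
    show ?thesis
      by (rule exI[of _ 1]) (simp add: Affine swap_xy_map_def oconj_simps oconj_omult)
  next
    case Vertical
    show ?thesis by (rule exI[of _ 1]) (simp add: Vertical swap_xy_map_def oconj_simps)
  qed
qed

lemma induces_swap_x1: "induces swap_x1_map swap_x1"
  unfolding induces_def
proof
  fix p
  show "\<exists>k. k \<noteq> 0 \<and> swap_x1_map (veronese p) = k *\<^sub>R veronese (swap_x1 p)"
  proof (cases p)
    case (Affine x y)
    show ?thesis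
    proof (cases "x = 0")
      case True
      then show ?thesis by (auto intro!: exI[of _ 1] simp: Affine swap_x1_map_def oconj_simps)
    next
      case False
      then have n: "(norm x)\<^sup>2 \<noteq> 0" by simp
      have 1: "(norm x)\<^sup>2 *\<^sub>R oinv x = oconj x" using n by (simp add: oinv_def)
      have 2: "(norm x)\<^sup>2 *\<^sub>R omult y (oinv x) = omult y (oconj x)"
        by (simp add: 1 flip: omult.scaleR_right)
      then have 3: "(norm x)\<^sup>2 *\<^sub>R omult (oconj (oinv x)) (oconj y) = omult x (oconj y)"
        by (metis oconj_omult oconj_oconj linear_scale[OF linear_oconj])
      have 4: "(norm x)\<^sup>2 *\<^sub>R omult (omult y (oinv x)) (oconj (oinv x)) = y"
        using n by (simp add: omult_oconj_cancel_right norm_oinv power_inverse)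
      \<comment> \<open>The column (y, 1, x) has to be divided by x to end in 1, whence the squared
        norm of x as factor.\<close>
      show ?thesis using n
        by (intro exI[of _ "(norm x)\<^sup>2"])
          (simp add: Affine swap_x1_map_def norm_omult norm_oinv oconj_omult 1 2 3 4
            power_mult_distrib power_inverse)
    qed
  next
    case (Slope s)
    show ?thesis by (rule exI[of _ 1]) (simp add: Slope swap_x1_map_def oconj_simps)
  next
    case Vertical
    show ?thesis by (rule exI[of _ 1]) (simp add: Vertical swap_x1_map_def oconj_simps)
  qed
qed

section \<open>Triangles and elementary collineations\<close>

text \<open>Both properties are carried along: line preservation is checked directly for the
  elementary maps and later serves to derive it for every element of \<open>e6\<close>.\<close>

definition realizable :: "(octonion plane_point \<Rightarrow> octonion plane_point) \<Rightarrow> bool" where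
  "realizable f \<longleftrightarrow> line_preserving f \<and> (\<exists>g\<in>e6. induces g f)"

lemma realizable_o:
  assumes "realizable f" "realizable h"
  shows "realizable (f \<circ> h)"
proof -
  obtain g g' where "g \<in> e6" "g' \<in> e6" "induces g f" "induces g' h"
    using assms unfolding realizable_def by blast
  moreover have "linear g" using \<open>g \<in> e6\<close> by (simp add: e6_def)
  ultimately have "g \<circ> g' \<in> e6" "induces (g \<circ> g') (f \<circ> h)" using e6_o induces_o by blast+
  then show ?thesis using assms line_preserving_o unfolding realizable_def by blast
qed

lemma realizable_generators: "realizable (translate b)" "realizable swap_xy" "realizable swap_x1"
  unfolding realizable_def
  using line_preserving_translate line_preserving_swap_xy line_preserving_swap_x1
    translate_map_e6 swap_xy_map_e6 swap_x1_map_e6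
    induces_translate induces_swap_xy induces_swap_x1
  by blast+

lemma realizable_to_Vertical: "\<exists>f. realizable f \<and> f p = Vertical"
proof -
  \<comment> \<open>The point (0, q) is moved to the origin, then to \<open>Slope 0\<close>, then to
    \<open>Vertical\<close>.\<close>
  have A: "\<exists>f. realizable f \<and> f (Affine 0 q) = Vertical" for q
    by (rule exI[of _ "swap_xy \<circ> (swap_x1 \<circ> translate (- q))"])
      (intro conjI realizable_o realizable_generators, simp)
  show ?thesis
  proof (cases p)
    case (Affine x y)
    obtain f where "realizable f" "f (Affine 0 x) = Vertical" using A by blast
    then show ?thesis
      by (intro exI[of _ "f \<circ> (swap_xy \<circ> translate (- y))"] conjI realizable_o realizable_generators)
        (simp_all add: Affine)
  next
    case (Slope s)
    obtain f where "realizable f" "f (Affine 0 s) = Vertical" using A by blast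
    then show ?thesis
      by (intro exI[of _ "f \<circ> swap_x1"] conjI realizable_o realizable_generators)
        (simp_all add: Slope)
  next
    case Vertical
    show ?thesis
      by (rule exI[of _ "translate 0"]) (simp add: Vertical realizable_generators)
  qed
qed

lemma realizable_fix_Vertical:
  assumes "p \<noteq> Vertical"
  shows "\<exists>f. realizable f \<and> f Vertical = Vertical \<and> f p = Slope 0"
proof -
  \<comment> \<open>Conjugating \<open>translate (- x)\<close> by \<open>swap_xy\<close> translates
    the first coordinate. Once the point is at the origin, \<open>swap_x1\<close> sends it to
    \<open>Slope 0\<close>.\<close>
  have A: "\<exists>f. realizable f \<and> f Vertical = Vertical \<and> f (Affine x y) = Slope 0" for x y
    by (rule exI[of _ "swap_x1 \<circ> (swap_xy \<circ> (translate (- x) \<circ> (swap_xy \<circ> translate (- y))))"])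
      (intro conjI realizable_o realizable_generators, simp_all)
  show ?thesis
  proof (cases p)
    case (Affine x y)
    then show ?thesis using A by simp
  next
    case (Slope s)
    obtain f where "realizable f" "f Vertical = Vertical" "f (Affine 0 s) = Slope 0"
      using A by blast
    then show ?thesis
      by (intro exI[of _ "f \<circ> swap_x1"] conjI realizable_o realizable_generators)
        (simp_all add: Slope)
  qed (use assms in simp)
qed

lemma realizable_pair:
  assumes "p \<noteq> q"
  shows "\<exists>f. realizable f \<and> f p = Vertical \<and> f q = Slope 0"
proof -
  obtain f where f: "realizable f" "f p = Vertical" using realizable_to_Vertical by blast
  then have "f q \<noteq> Vertical"
    using assms unfolding realizable_def line_preserving_def by (metis bij_pointE)
  then obtain h where "realizable h" "h Vertical = Vertical" "h (f q) = Slope 0"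
    using realizable_fix_Vertical by blast
  then show ?thesis
    by (intro exI[of _ "h \<circ> f"]) (simp add: f realizable_o)
qed

lemma iline_unique: "l \<in> olines \<Longrightarrow> Vertical \<in> l \<Longrightarrow> Slope s \<in> l \<Longrightarrow> l = iline"
  by (auto elim: olinesE)

lemma line_preserving_vimage:
  assumes "line_preserving f" "l \<in> olines"
  shows "{x. f x \<in> l} \<in> olines"
proof -
  have "surj f" using assms(1) by (simp add: line_preserving_def bij_is_surj)
  then have "f ` {x. f x \<in> l} = l" by (simp add: vimage_def[symmetric] surj_image_vimage_eq)
  then show ?thesis using assms by (metis line_preserving_def)
qed

text \<open>With p and q at infinity, r becomes affine, since otherwise the preimage of
  \<open>iline\<close> would be a line through all three points. Translations of both coordinates
  then bring r to the origin and fix \<open>Vertical\<close> and \<open>Slope 0\<close>.\<close>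

lemma realizable_triangle:
  assumes "p \<noteq> q" and non: "\<And>l. l \<in> olines \<Longrightarrow> p \<in> l \<Longrightarrow> q \<in> l \<Longrightarrow> r \<notin> l"
  shows "\<exists>f. realizable f \<and> f p = Vertical \<and> f q = Slope 0 \<and> f r = Affine 0 0"
proof -
  obtain f where f: "realizable f" "f p = Vertical" "f q = Slope 0"
    using realizable_pair[OF assms(1)] by blast
  have "{x. f x \<in> iline} \<in> olines"
    using f(1) line_preserving_vimage by (auto simp: realizable_def)
  then have "f r \<notin> iline" using non[of "{x. f x \<in> iline}"] f by simp
  then obtain x y where xy: "f r = Affine x y" by (cases "f r") auto
  show ?thesis
    by (rule exI[of _ "swap_xy \<circ> (translate (- x) \<circ> (swap_xy \<circ> translate (- y))) \<circ> f"])
      (intro conjI realizable_o realizable_generators f(1), simp_all add: f xy)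
qed

section \<open>Elements of rank one\<close>

text \<open>Written through values of the determinant on sums, the polarisation is evidently
  invariant under additive maps preserving the determinant.\<close>

definition polar_det :: "albert \<Rightarrow> albert \<Rightarrow> albert \<Rightarrow> real" where
  "polar_det X Y Z = albert_det (X + Y + Z) - albert_det (X + Y) - albert_det (X + Z)
     - albert_det (Y + Z) + albert_det X + albert_det Y + albert_det Z"

text \<open>The derivative of the determinant at the first argument in the direction of the second,
  that is, the pairing of Freudenthal's adjoint of the first with the second.\<close>

definition det_deriv :: "albert \<Rightarrow> albert \<Rightarrow> real" where
  "det_deriv = (\<lambda>(a, b, c, x, y, z) (a', b', c', x', y', z').
     a' * (b * c - x \<bullet> x) + b' * (c * a - y \<bullet> y) + c' * (a * b - z \<bullet> z) +
     2 * (omult x' y \<bullet> oconj z + omult x y' \<bullet> oconj z + omult x y \<bullet> oconj z'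
       - a * (x \<bullet> x') - b * (y \<bullet> y') - c * (z \<bullet> z')))"

text \<open>Cyclic rotation of the triple product isolates each octonion of the direction, so that
  the entries of the gradient can be read off.\<close>

lemma det_deriv_gradient:
  "det_deriv (a, b, c, x, y, z) (a', b', c', x', y', z') =
     a' * (b * c - x \<bullet> x) + b' * (c * a - y \<bullet> y) + c' * (a * b - z \<bullet> z) +
     2 * (x' \<bullet> (oconj (omult y z) - a *\<^sub>R x) + y' \<bullet> (oconj (omult z x) - b *\<^sub>R y) +
       z' \<bullet> (oconj (omult x y) - c *\<^sub>R z))"
proof -
  have "omult x' y \<bullet> oconj z = x' \<bullet> oconj (omult y z)"
    by (metis inner_omult_swap_right oconj_omult)
  moreover have "omult x y' \<bullet> oconj z = y' \<bullet> oconj (omult z x)"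
    by (metis inner_omult_swap_left oconj_omult)
  moreover have "omult x y \<bullet> oconj z' = z' \<bullet> oconj (omult x y)"
    by (metis inner_commute inner_oconj_left)
  ultimately show ?thesis by (simp add: det_deriv_def inner_diff_right inner_commute)
qed

lemma albert_det_add:
  "albert_det (X + Y) = albert_det X + det_deriv X Y + det_deriv Y X + albert_det Y"
  by (cases X rule: albert_cases; cases Y rule: albert_cases)
    (simp add: albert_det_inner det_deriv_def oconj_simps inner_add omult.add_left omult.add_right algebra_simps inner_commute)

text \<open>Expressing the derivative through an invariant form shows later that rank one is
  preserved by \<open>e6\<close>. It follows by expanding the determinant at 2 X + Y and using
  homogeneity.\<close>

lemma polar_det_same: "polar_det X X Y = 2 * det_deriv X Y"
proof -
  have 1: "det_deriv (2 *\<^sub>R X) Y = 4 * det_deriv X Y" "det_deriv Y (2 *\<^sub>R X) = 2 * det_deriv Y X"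
    "albert_det (2 *\<^sub>R X) = 8 * albert_det X"
    by (cases X rule: albert_cases; cases Y rule: albert_cases;
        simp add: det_deriv_def albert_det_inner omult.scaleR_left omult.scaleR_right oconj_simps algebra_simps)+
  have "polar_det X X Y = albert_det (2 *\<^sub>R X + Y) - albert_det (2 *\<^sub>R X)
     - 2 * albert_det (X + Y) + 2 * albert_det X + albert_det Y"
    by (simp add: polar_det_def scaleR_2)
  then show ?thesis by (simp only: albert_det_add 1) simp
qed

lemma det_deriv_eq_0_iff:
  "(\<forall>Y. det_deriv (a, b, c, x, y, z) Y = 0) \<longleftrightarrow>
     b * c = x \<bullet> x \<and> c * a = y \<bullet> y \<and> a * b = z \<bullet> z \<and>
     a *\<^sub>R x = oconj (omult y z) \<and> b *\<^sub>R y = oconj (omult z x) \<and> c *\<^sub>R z = oconj (omult x y)"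
    (is "?L \<longleftrightarrow> ?R")
proof
  assume ?L
  then have L: "det_deriv (a, b, c, x, y, z) Y = 0" for Y by blast
  \<comment> \<open>Real unit directions give the diagonal equations. An octonionic gradient entry
    is tested against itself, which yields twice its squared norm.\<close>
  show ?R
    using L[of "(1, 0, 0, 0, 0, 0)"] L[of "(0, 1, 0, 0, 0, 0)"] L[of "(0, 0, 1, 0, 0, 0)"]
      L[of "(0, 0, 0, oconj (omult y z) - a *\<^sub>R x, 0, 0)"]
      L[of "(0, 0, 0, 0, oconj (omult z x) - b *\<^sub>R y, 0)"]
      L[of "(0, 0, 0, 0, 0, oconj (omult x y) - c *\<^sub>R z)"]
    by (simp add: det_deriv_gradient)
next
  assume ?R
  show ?L
  proof
    fix Y
    show "det_deriv (a, b, c, x, y, z) Y = 0"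
      using \<open>?R\<close> by (cases Y rule: albert_cases) (simp add: det_deriv_gradient)
  qed
qed

lemma det_deriv_veronese: "det_deriv (veronese p) Y = 0"
proof -
  have "\<forall>Y. det_deriv (veronese p) Y = 0"
  proof (cases p)
    case (Affine x y)
    have "omult (oconj y) (omult y (oconj x)) = (norm y)\<^sup>2 *\<^sub>R oconj x"
      "omult (omult y (oconj x)) x = (norm x)\<^sup>2 *\<^sub>R y"
      using omult_oconj_cancel_left[of y "oconj x"] omult_oconj_cancel_right[of y "oconj x"]
      by simp_all
    then show ?thesis
      by (simp only: Affine veronese.simps det_deriv_eq_0_iff)
        (simp add: oconj_omult oconj_simps norm_omult power_mult_distrib flip: power2_norm_eq_inner)
  qed (simp_all only: veronese.simps det_deriv_eq_0_iff, simp_all add: oconj_simps power2_norm_eq_inner)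
  then show ?thesis by blast
qed

lemma veronese_neq_0: "veronese p \<noteq> 0"
  by (cases p) (simp_all add: zero_prod_def)

lemma veronese_inj:
  assumes "k \<noteq> 0" "veronese p = k *\<^sub>R veronese q"
  shows "p = q"
proof -
  have inj: "oconj x = oconj y \<longleftrightarrow> x = y" for x y by (metis oconj_oconj)
  show ?thesis using assms by (cases p; cases q) (simp_all add: inj, clarsimp simp: inj)
qed

text \<open>The first nonzero entry among c, b, a serves as the scale, matching the normalisation of
  \<open>veronese\<close>. The rank one equations then determine the other entries.\<close>

lemma rank_one_veronese:
  assumes "X \<noteq> 0" "\<And>Y. det_deriv X Y = 0"
  shows "\<exists>k p. k \<noteq> 0 \<and> X = k *\<^sub>R veronese p"
proof -
  obtain a b c x y z where X: "X = (a, b, c, x, y, z)" by (rule albert_cases)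
  have R: "b * c = x \<bullet> x" "c * a = y \<bullet> y" "a * b = z \<bullet> z"
      "c *\<^sub>R z = oconj (omult x y)"
    using assms(2) det_deriv_eq_0_iff[of a b c x y z] unfolding X by auto
  consider (1) "c \<noteq> 0" | (2) "c = 0" "b \<noteq> 0" | (3) "c = 0" "b = 0" by blast
  then show ?thesis
  proof cases
    case 1
    have "a = (y \<bullet> y) / c" "b = (x \<bullet> x) / c" using R(1,2) 1 by (simp_all add: field_simps)
    then have "a = c * (norm (oconj (y /\<^sub>R c)))\<^sup>2" "b = c * (norm (x /\<^sub>R c))\<^sup>2"
      using 1 by (simp_all add: power_mult_distrib power2_norm_eq_inner)
        (simp_all add: field_simps power2_eq_square)
    moreover have "z = c *\<^sub>R omult (oconj (y /\<^sub>R c)) (oconj (x /\<^sub>R c))"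
      using R(4) 1
      by (simp add: oconj_simps omult.scaleR_left omult.scaleR_right flip: oconj_omult R(4))
    ultimately have "X = c *\<^sub>R veronese (Affine (x /\<^sub>R c) (oconj (y /\<^sub>R c)))"
      using 1 by (simp add: X)
    then show ?thesis using 1 by blast
  next
    case 2
    then have "x = 0" "y = 0" "a = (z \<bullet> z) / b" using R by (auto simp: field_simps)
    moreover from this have "a = b * (norm (z /\<^sub>R b))\<^sup>2"
      using 2 by (simp add: power_mult_distrib power2_norm_eq_inner)
        (simp add: field_simps power2_eq_square)
    ultimately have "X = b *\<^sub>R veronese (Slope (z /\<^sub>R b))" using 2 by (simp add: X)
    then show ?thesis using 2 by blast
  next
    case 3
    then have "X = a *\<^sub>R veronese Vertical" using R by (auto simp: X)
    moreover have "a \<noteq> 0" using calculation assms(1) by (auto simp: zero_prod_def)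
    ultimately show ?thesis by blast
  qed
qed

section \<open>Action of the determinant-preserving maps on points and lines\<close>

lemma polar_det_e6:
  assumes "g \<in> e6"
  shows "polar_det (g X) (g Y) (g Z) = polar_det X Y Z"
proof -
  have g: "g (X + Y) = g X + g Y" and d: "albert_det (g X) = albert_det X" for X Y
    using assms by (auto simp: e6_def linear_add)
  show ?thesis by (simp only: polar_det_def d flip: g)
qed

text \<open>Rank one of X means that \<open>polar_det X X\<close> vanishes in every direction. This
  survives \<open>g\<close> because \<open>g\<close> preserves the form and reaches every
  direction.\<close>

lemma e6_induces:
  assumes "g \<in> e6"
  shows "\<exists>f. induces g f"
proof -
  have g: "bij g" "linear g" using assms by (auto simp: e6_def)
  have "\<exists>q k. k \<noteq> 0 \<and> g (veronese p) = k *\<^sub>R veronese q" for p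
  proof -
    have "det_deriv (g (veronese p)) Y = 0" for Y
    proof -
      obtain Z where "Y = g Z" using g(1) by (metis bij_pointE)
      then show ?thesis
        using polar_det_e6[OF assms, of "veronese p" "veronese p" Z] by (simp add: polar_det_same det_deriv_veronese)
    qed
    moreover have "g (veronese p) \<noteq> 0"
      using g veronese_neq_0 by (metis bij_is_inj linear_injective_0)
    ultimately show ?thesis using rank_one_veronese by blast
  qed
  then show ?thesis unfolding induces_def by metis
qed

lemma induces_unique:
  assumes "induces g f" "induces g f'"
  shows "f = f'"
proof
  fix p
  obtain k k' where "k \<noteq> 0" "k' \<noteq> 0" "g (veronese p) = k *\<^sub>R veronese (f p)"
    "g (veronese p) = k' *\<^sub>R veronese (f' p)"
    using assms unfolding induces_def by meson
  then have "inverse k *\<^sub>R k *\<^sub>R veronese (f p) = inverse k *\<^sub>R k' *\<^sub>R veronese (f' p)" by simp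
  then have "veronese (f p) = (inverse k * k') *\<^sub>R veronese (f' p)"
    by (simp only: scaleR_scaleR left_inverse[OF \<open>k \<noteq> 0\<close>] scaleR_one)
  moreover have "inverse k * k' \<noteq> 0" using \<open>k \<noteq> 0\<close> \<open>k' \<noteq> 0\<close> by simp
  ultimately show "f p = f' p" by (rule veronese_inj[rotated])
qed

lemma induces_id: "induces id id"
  unfolding induces_def using zero_neq_one by (metis id_apply scaleR_one)

lemma induces_inv:
  assumes "g \<in> e6" "induces g f" "induces (inv_into UNIV g) f'"
  shows "f (f' p) = p" "f' (f p) = p"
proof -
  have g: "bij g" "linear g" using assms by (auto simp: e6_def)
  have l: "linear (inv_into UNIV g)" using e6_inv[OF assms(1)] by (simp add: e6_def)
  have "g \<circ> inv_into UNIV g = id" "inv_into UNIV g \<circ> g = id"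
    using g(1) by (simp_all add: fun_eq_iff bij_is_surj surj_f_inv_f bij_is_inj)
  then have "induces id (f \<circ> f')" "induces id (f' \<circ> f)"
    using induces_o[OF assms(3,2) g(2)] induces_o[OF assms(2,3) l] by simp_all
  then show "f (f' p) = p" "f' (f p) = p"
    using induces_unique induces_id by (metis comp_apply id_apply)+
qed

lemma induces_bij:
  assumes "g \<in> e6" "induces g f"
  shows "bij f"
proof -
  obtain f' where "induces (inv_into UNIV g) f'" using e6_induces[OF e6_inv[OF assms(1)]] by blast
  from induces_inv[OF assms this] show ?thesis by (intro o_bij[of f']) (simp_all add: fun_eq_iff)
qed

text \<open>In standard position the polar form is a nonzero multiple of the entry c, which is 1 for
  affine points and 0 at infinity. Invariance carries this back to p, q and r.\<close>

lemma induces_line: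
  assumes "g \<in> e6" "induces g f" "f p = Vertical" "f q = Slope 0"
  shows "polar_det (veronese p) (veronese q) (veronese r) = 0 \<longleftrightarrow> f r \<in> iline"
proof -
  obtain i j k where k: "k \<noteq> 0" "g (veronese r) = k *\<^sub>R veronese (f r)"
    and i: "i \<noteq> 0" "g (veronese p) = i *\<^sub>R veronese Vertical"
    and j: "j \<noteq> 0" "g (veronese q) = j *\<^sub>R veronese (Slope 0)"
    using assms unfolding induces_def by metis
  have "polar_det (i *\<^sub>R veronese Vertical) (j *\<^sub>R veronese (Slope 0)) (a, b, c, x, y, z) = i * j * c"
    for a b c x y z
    by (simp add: polar_det_def albert_det_inner oconj_simps algebra_simps)
  then have "polar_det (i *\<^sub>R veronese Vertical) (j *\<^sub>R veronese (Slope 0)) (k *\<^sub>R veronese (f r)) = 0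
      \<longleftrightarrow> f r \<in> iline"
    using k(1) i(1) j(1) by (cases "f r") simp_all
  then show ?thesis using polar_det_e6[OF assms(1)] k(2) i(2) j(2) by metis
qed

text \<open>Moving p and q into standard position turns the line into \<open>iline\<close>. Lines
  are thereby described by a form that all of \<open>e6\<close> preserves.\<close>

lemma line_through:
  assumes "l \<in> olines" "p \<in> l" "q \<in> l" "p \<noteq> q"
  shows "l = {r. polar_det (veronese p) (veronese q) (veronese r) = 0}"
proof -
  obtain f g where f: "line_preserving f" "g \<in> e6" "induces g f" "f p = Vertical" "f q = Slope 0"
    using realizable_pair[OF assms(4)] by (auto simp: realizable_def)
  have "f ` l \<in> olines" "Vertical \<in> f ` l" "Slope 0 \<in> f ` l"
    using assms f(1,4,5) unfolding line_preserving_def by (blast, (metis imageI)+)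
  then have "f ` l = iline" by (rule iline_unique)
  then have "r \<in> l \<longleftrightarrow> f r \<in> iline" for r
    using f(1) unfolding line_preserving_def by (metis bij_is_inj inj_image_mem_iff)
  then show ?thesis using induces_line[OF f(2-5)] by auto
qed

lemma line_two_points:
  assumes "l \<in> olines"
  shows "\<exists>p q. p \<in> l \<and> q \<in> l \<and> p \<noteq> q"
  using assms
proof (cases rule: olinesE)
  case (1 s t)
  then show ?thesis by (intro exI[of _ "Slope s"] exI[of _ "Affine 0 t"]) simp
next
  case (2 c)
  then show ?thesis by (intro exI[of _ Vertical] exI[of _ "Affine c 0"]) simp
next
  case 3
  then show ?thesis by (intro exI[of _ Vertical] exI[of _ "Slope 0"]) simp
qed

lemma line_unique:
  assumes "l \<in> olines" "m \<in> olines" "p \<noteq> q" "p \<in> l" "q \<in> l" "p \<in> m" "q \<in> m"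
  shows "l = m"
  using assms line_through by metis

text \<open>An elementary \<open>h\<close> brings the images of two points of \<open>l\<close> to
  \<open>Vertical\<close> and \<open>Slope 0\<close>. The polar criterion for
  \<open>h \<circ> f\<close> then identifies the image of \<open>l\<close> with the preimage of
  \<open>iline\<close> under \<open>h\<close>.\<close>

lemma induces_image_line:
  assumes "g \<in> e6" "induces g f" "l \<in> olines"
  shows "f ` l \<in> olines"
proof -
  obtain p q where pq: "p \<in> l" "q \<in> l" "p \<noteq> q" using line_two_points[OF assms(3)] by blast
  have "bij f" using induces_bij[OF assms(1,2)] .
  have "f p \<noteq> f q" using pq(3) \<open>bij f\<close> by (metis bij_pointE)
  then obtain h g' where h: "line_preserving h" "g' \<in> e6" "induces g' h"
      "h (f p) = Vertical" "h (f q) = Slope 0"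
    using realizable_pair unfolding realizable_def by blast
  have "g' \<circ> g \<in> e6" "induces (g' \<circ> g) (h \<circ> f)"
    using e6_o h(2) assms(1) by (blast, intro induces_o assms(2) h(3))
      (use h(2) in \<open>simp add: e6_def\<close>)
  from induces_line[OF this, of p q]
  have "r \<in> l \<longleftrightarrow> h (f r) \<in> iline" for r
    using line_through[OF assms(3) pq] h(4,5) by auto
  then have "f ` l = {x. h x \<in> iline}"
    using \<open>bij f\<close> by (intro Set.set_eqI) (metis (mono_tags, lifting) bij_pointE image_iff mem_Collect_eq)
  then show ?thesis using line_preserving_vimage[OF h(1)] by auto
qed

section \<open>Collineations fixing a triangle\<close>

text \<open>Nonnegative reals are squares, so \<open>h\<close> is monotone. It fixes the rationals,
  which are dense.\<close>

lemma real_ring_hom_id: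
  fixes h :: "real \<Rightarrow> real"
  assumes add: "\<And>x y. h (x + y) = h x + h y" and mult: "\<And>x y. h (x * y) = h x * h y"
    and one: "h 1 = 1"
  shows "h x = x"
proof -
  interpret Modules.additive h by unfold_locales (rule add)
  have mono: "h x \<le> h y" if "x \<le> y" for x y
  proof -
    have "h (y - x) = h (sqrt (y - x)) * h (sqrt (y - x))"
      using that by (simp flip: mult)
    then have "0 \<le> h (y - x)" by simp
    then show ?thesis by (simp add: diff)
  qed
  have nat: "h (of_nat n) = of_nat n" for n
    by (induction n) (simp_all add: zero add one)
  have int: "h (of_int i) = of_int i" for i
    by (cases i rule: int_diff_cases) (simp add: diff nat)
  have rat: "h (of_rat q) = of_rat q" for q
  proof -
    obtain a b where q: "q = Fract a b" "b > 0" by (cases q) auto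
    then have "of_rat q * real_of_int b = of_int a" by (simp add: of_rat_rat)
    then have "h (of_rat q) * of_int b = of_rat q * of_int b"
      by (metis mult int)
    then show ?thesis using q(2) by simp
  qed
  show ?thesis
  proof (rule ccontr)
    assume "h x \<noteq> x"
    then consider "h x < x" | "x < h x" by linarith
    then show False
    proof cases
      case 1
      then obtain q where "h x < of_rat q" "of_rat q < x" using of_rat_dense by blast
      then show False using mono[of "of_rat q" x] by (simp add: rat)
    next
      case 2
      then obtain q where "x < of_rat q" "of_rat q < h x" using of_rat_dense by blast
      then show False using mono[of x "of_rat q"] by (simp add: rat)
    qed
  qed
qed

text \<open>Distinct imaginary basis units anticommute, so commuting with these four leaves only the
  real coordinate.\<close>

lemma omult_central:
  assumes "\<And>v. omult n v = omult v n"
  shows "\<exists>r. n = r *\<^sub>R oone"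
  using assms[of "((\<i>, 0), (0, 0))"] assms[of "((0, 1), (0, 0))"] assms[of "((0, 0), (1, 0))"]
    assms[of "((0, 0), (0, 1))"]
  by (intro exI[of _ "ore n"]) (simp add: octonion_eq_iff octonion_defs)

section \<open>Autotopisms of the octonions\<close>

locale autotopism =
  fixes A B C :: "octonion \<Rightarrow> octonion"
  assumes mult: "C (omult s x) = omult (A s) (B x)"
    and bij: "bij A" "bij B" "bij C"
    and C_add: "C (x + y) = C x + C y"
begin

lemma C_0: "C 0 = 0"
  using C_add[of 0 0] by simp

lemma C_eq_0: "C x = 0 \<longleftrightarrow> x = 0"
  by (metis C_0 bij(3) bij_pointE)

lemma C_oone: "C oone = omult (A oone) (B oone)"
  using mult[of oone oone] by simp

lemma A_oone: "A oone \<noteq> 0" and B_oone: "B oone \<noteq> 0"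
  using C_eq_0[of oone] by (auto simp: C_oone)

lemma A_eq: "A s = omult (C s) (oinv (B oone))"
  using mult[of s oone] B_oone by (simp add: oinv_cancel)

lemma B_eq: "B x = omult (oinv (A oone)) (C x)"
  using mult[of oone x] A_oone by (simp add: oinv_cancel)

text \<open>Transporting multiplication by \<open>r\<close> along \<open>A\<close>, \<open>B\<close>, \<open>C\<close> gives maps \<open>E\<close>, \<open>F\<close>, \<open>D\<close> with
  \<open>D (u v) = E u v = u F v\<close>; hence \<open>D\<close> is the multiplication by a central element.\<close>

lemma C_scale_ex: "\<exists>r'. \<forall>u. C (r *\<^sub>R u) = r' *\<^sub>R C u"
proof -
  define D where "D u = C (r *\<^sub>R inv_into UNIV C u)" for u
  define E where "E u = A (r *\<^sub>R inv_into UNIV A u)" for u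
  define F where "F u = B (r *\<^sub>R inv_into UNIV B u)" for u
  have DC: "D (C u) = C (r *\<^sub>R u)" for u
    using bij(3) by (simp add: D_def bij_is_inj)
  have DE: "D (omult u v) = omult (E u) v" and DF: "D (omult u v) = omult u (F v)" for u v
  proof -
    obtain s x where sx: "u = A s" "v = B x" using bij by (metis bij_pointE)
    have "D (omult u v) = C (r *\<^sub>R omult s x)" by (simp add: sx DC flip: mult)
    then have 1: "D (omult u v) = C (omult (r *\<^sub>R s) x)" "D (omult u v) = C (omult s (r *\<^sub>R x))"
      by (simp_all add: omult.scaleR_left omult.scaleR_right)
    show "D (omult u v) = omult (E u) v"
      unfolding 1(1) mult using bij by (simp add: sx E_def bij_is_inj)
    show "D (omult u v) = omult u (F v)"
      unfolding 1(2) mult using bij by (simp add: sx F_def bij_is_inj)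
  qed
  have "D v = omult (E oone) v" "D v = omult v (F oone)" for v
    using DE[of oone v] DF[of v oone] by simp_all
  moreover from this[of oone] have "E oone = F oone" by simp
  ultimately obtain r' where "D v = r' *\<^sub>R v" for v
    using omult_central[of "E oone"] by (metis omult.scaleR_left omult_oone(2))
  then show ?thesis using DC by metis
qed

text \<open>The factor replacing r in \<open>C_scale_ex\<close> is additive and multiplicative in r,
  hence a ring endomorphism of the reals, which is the identity.\<close>

lemma C_linear: "linear C"
proof -
  obtain h where h: "C (r *\<^sub>R u) = h r *\<^sub>R C u" for r u using C_scale_ex by metis
  have "C oone \<noteq> 0" using C_eq_0 by simp
  then have inj: "a *\<^sub>R C oone = b *\<^sub>R C oone \<longleftrightarrow> a = b" for a b by simp
  have "h (r + s) = h r + h s" for r s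
    using C_add[of "r *\<^sub>R oone" "s *\<^sub>R oone"] inj by (simp add: h flip: scaleR_left_distrib)
  moreover have "h (r * s) = h r * h s" for r s
    using h[of "r * s" oone] h[of r "s *\<^sub>R oone"] \<open>C oone \<noteq> 0\<close> by (simp add: h)
  moreover have "h 1 = 1" using h[of 1 oone] \<open>C oone \<noteq> 0\<close> by (metis inj scaleR_one)
  ultimately have "h r = r" for r by (rule real_ring_hom_id)
  then show ?thesis by (intro linearI) (simp_all add: C_add h)
qed

lemma A_linear: "linear A"
  by (rule linearI; simp add: A_eq linear_add[OF C_linear] linear_scale[OF C_linear]
      omult.add_left omult.scaleR_left)

lemma B_linear: "linear B"
  by (rule linearI; simp add: B_eq linear_add[OF C_linear] linear_scale[OF C_linear]
      omult.add_right omult.scaleR_right)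

definition "\<alpha> = norm (A oone)"
definition "\<beta> = norm (B oone)"

lemma pos: "\<alpha> > 0" "\<beta> > 0"
  using A_oone B_oone by (simp_all add: \<alpha>_def \<beta>_def)

lemma norm_C_AB: "norm (C x) = norm (A x) * \<beta>" "norm (C x) = \<alpha> * norm (B x)"
  using arg_cong[OF mult[of x oone], of norm] arg_cong[OF mult[of oone x], of norm]
  by (simp_all only: norm_omult omult_oone \<alpha>_def \<beta>_def)

text \<open>The function \<open>N x = |C x| / (\<alpha> \<beta>)\<close> is multiplicative and bounded by a multiple of the norm, so
  evaluating it on powers of \<open>x\<close> bounds it by the norm itself; inverses give the reverse bound.\<close>

lemma norm_C: "norm (C x) = \<alpha> * \<beta> * norm x"
proof -
  define N where "N x = norm (C x) / (\<alpha> * \<beta>)" for x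
  have N_mult: "N (omult x y) = N x * N y" for x y
  proof -
    have "N (omult x y) = norm (A x) * norm (B y) / (\<alpha> * \<beta>)"
      by (simp add: N_def mult norm_omult)
    also have "\<dots> = N x * N y"
      using pos by (simp add: N_def norm_C_AB(1)[of x] norm_C_AB(2)[of y])
    finally show ?thesis .
  qed
  have N_1: "N oone = 1" using pos by (simp add: N_def C_oone norm_omult \<alpha>_def \<beta>_def)
  have N_nonneg: "N x \<ge> 0" for x using pos by (simp add: N_def)
  obtain K where K: "norm (C x) \<le> K * norm x" for x
    using linear_bounded_pos[OF C_linear] by blast
  have N_le: "N x \<le> norm x" for x
  proof (rule ccontr)
    assume "\<not> N x \<le> norm x"
    then have gt: "norm x < N x" by simp
    have x: "x \<noteq> 0" using gt by (auto simp: N_def C_0)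
    have pow: "N ((omult x ^^ k) oone) = N x ^ k \<and> norm ((omult x ^^ k) oone) = norm x ^ k" for k
      by (induction k) (simp_all add: N_1 N_mult norm_omult)
    obtain k where k: "K / (\<alpha> * \<beta>) < (N x / norm x) ^ k"
      using real_arch_pow[of "N x / norm x"] gt x by auto
    have "N x ^ k \<le> K / (\<alpha> * \<beta>) * norm x ^ k"
    proof -
      have "N ((omult x ^^ k) oone) \<le> K * norm ((omult x ^^ k) oone) / (\<alpha> * \<beta>)"
        unfolding N_def using K pos by (intro divide_right_mono) auto
      then show ?thesis by (simp add: pow)
    qed
    moreover have "K / (\<alpha> * \<beta>) * norm x ^ k < N x ^ k"
      using k x by (simp add: power_divide field_simps)
    ultimately show False by simp
  qed
  have "N x = norm x"
  proof (cases "x = 0")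
    case False
    have "N x * N (oinv x) = 1" using False by (simp add: omult_oinv N_1 flip: N_mult)
    moreover have "N x * N (oinv x) \<le> N x * inverse (norm x)"
      using N_le[of "oinv x"] N_nonneg[of x] by (simp add: norm_oinv mult_left_mono)
    ultimately have "norm x \<le> N x" using False by (simp add: field_simps)
    then show ?thesis using N_le[of x] by simp
  qed (simp add: N_def C_0)
  then show ?thesis using pos by (simp add: N_def field_simps)
qed

lemma norm_A: "norm (A x) = \<alpha> * norm x" and norm_B: "norm (B x) = \<beta> * norm x"
  using norm_C_AB[of x] pos by (simp_all add: norm_C)

lemma inner_C: "C x \<bullet> C y = (\<alpha> * \<beta>)\<^sup>2 * (x \<bullet> y)"
  by (simp add: dot_norm norm_C power_mult_distrib algebra_simps flip: C_add)

text \<open>The weights are dictated by the Veronese vectors of affine points, as \<open>B\<close>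
  and \<open>C\<close> scale norms by \<beta> and \<alpha> \<beta>. They are balanced: every
  monomial of the determinant acquires the same factor.\<close>

definition albert_map :: "albert \<Rightarrow> albert" where
  "albert_map = (\<lambda>(a, b, c, x, y, z).
     ((\<alpha> * \<beta>)\<^sup>2 * a, \<beta>\<^sup>2 * b, c, B x, oconj (C (oconj y)), \<beta>\<^sup>2 *\<^sub>R A z))"

lemma albert_map_linear: "linear albert_map"
  by (rule albert_linearI)
    (simp_all add: albert_map_def oconj_simps C_add linear_add[OF A_linear] linear_add[OF B_linear]
      linear_scale[OF A_linear] linear_scale[OF B_linear] linear_scale[OF C_linear] algebra_simps)

lemma albert_det_albert_map: "albert_det (albert_map X) = (\<alpha> * \<beta>\<^sup>2)\<^sup>2 * albert_det X"
proof -
  have sq: "A z \<bullet> A z = \<alpha>\<^sup>2 * (z \<bullet> z)" "B z \<bullet> B z = \<beta>\<^sup>2 * (z \<bullet> z)" for z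
    by (simp_all add: norm_A norm_B power_mult_distrib flip: power2_norm_eq_inner)
  have rot: "omult x y \<bullet> oconj z = y \<bullet> oconj (omult z x)" for x y z
    by (metis inner_omult_swap_left oconj_omult)
  \<comment> \<open>Rotation brings \<open>A z\<close> and \<open>B x\<close> together, and
    \<open>mult\<close> turns their product into \<open>C (omult z x)\<close>.\<close>
  have "omult (B x) (oconj (C (oconj y))) \<bullet> oconj (A z) = (\<alpha> * \<beta>)\<^sup>2 * (omult x y \<bullet> oconj z)" for x y z
    by (simp only: rot inner_oconj flip: mult) (simp only: inner_C inner_oconj_left)
  then show ?thesis
    by (cases X rule: albert_cases)
      (simp add: albert_map_def albert_det_inner sq inner_C oconj_simps algebra_simps power2_eq_square)
qed

lemma albert_map_veronese:
  "albert_map (veronese (Affine p q)) = veronese (Affine (B p) (C q))"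
  "albert_map (veronese (Slope s)) = \<beta>\<^sup>2 *\<^sub>R veronese (Slope (A s))"
  "albert_map (veronese Vertical) = (\<alpha> * \<beta>)\<^sup>2 *\<^sub>R veronese Vertical"
proof -
  have "\<beta>\<^sup>2 *\<^sub>R A (omult q (oconj p)) = omult (C q) (oconj (B p))"
  proof (cases "p = 0")
    case True
    then show ?thesis by (simp add: oconj_simps linear_0[OF A_linear] linear_0[OF B_linear])
  next
    case False
    then have "B p \<noteq> 0" using norm_B[of p] pos by auto
    \<comment> \<open>Multiplied by \<open>B p\<close> on the right, both sides become the squared
      norm of \<open>B p\<close> times \<open>C q\<close>; on the left \<open>A\<close> and
      \<open>B\<close> merge into \<open>C\<close>.\<close>
    moreover have "omult (\<beta>\<^sup>2 *\<^sub>R A (omult q (oconj p))) (B p) = omult (omult (C q) (oconj (B p))) (B p)"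
      using omult_oconj_cancel_right[of q "oconj p"] omult_oconj_cancel_right[of "C q" "oconj (B p)"]
      by (simp add: omult.scaleR_left linear_scale[OF C_linear] norm_B power_mult_distrib flip: mult)
    ultimately show ?thesis by (simp add: omult_right_cancel)
  qed
  then show "albert_map (veronese (Affine p q)) = veronese (Affine (B p) (C q))"
    by (simp add: albert_map_def norm_B norm_C power_mult_distrib)
qed (simp_all add: albert_map_def norm_A power_mult_distrib oconj_simps C_0 linear_0[OF A_linear]
  linear_0[OF B_linear])

lemma albert_map_inj: "inj albert_map"
proof -
  have "X = 0" if "albert_map X = 0" for X
  proof -
    obtain a b c x y z where X: "X = (a, b, c, x, y, z)" by (rule albert_cases)
    have "B x = 0 \<Longrightarrow> x = 0" "A z = 0 \<Longrightarrow> z = 0" using norm_A[of z] norm_B[of x] pos by auto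
    moreover have "(a, b, c, x, y, z) = 0 \<longleftrightarrow> a = 0 \<and> b = 0 \<and> c = 0 \<and> x = 0 \<and> y = 0 \<and> z = 0"
      for a b c :: real and x y z :: octonion
      by (simp add: zero_prod_def)
    ultimately show ?thesis using that pos by (simp add: X albert_map_def C_eq_0)
  qed
  then show ?thesis using linear_injective_0[OF albert_map_linear] by blast
qed

lemma induced_e6:
  assumes "\<And>p q. f (Affine p q) = Affine (B p) (C q)" "\<And>s. f (Slope s) = Slope (A s)"
    "f Vertical = Vertical"
  shows "\<exists>g\<in>e6. induces g f"
proof -
  \<comment> \<open>The determinant is cubic, so a cube root compensates its factor.\<close>
  define k where "k = inverse (root 3 ((\<alpha> * \<beta>\<^sup>2)\<^sup>2))"
  define g where "g X = k *\<^sub>R albert_map X" for X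
  have k: "k > 0" using pos by (simp add: k_def)
  have k3: "k ^ 3 * (\<alpha> * \<beta>\<^sup>2)\<^sup>2 = 1" using pos by (simp add: k_def power_inverse)
  have lin: "linear g"
    unfolding g_def using albert_map_linear by (intro linearI) (simp_all add: linear_add linear_scale algebra_simps)
  have "inj g" using albert_map_inj k by (simp add: inj_def g_def)
  then have "bij g" using lin by (simp add: bij_def linear_injective_imp_surjective)
  moreover have scale: "albert_det (k *\<^sub>R X) = k ^ 3 * albert_det X" for X
    by (cases X rule: albert_cases)
      (simp add: albert_det_inner oconj_simps omult.scaleR_left omult.scaleR_right algebra_simps power3_eq_cube)
  have "albert_det (g X) = albert_det X" for X
    using k3 by (simp add: g_def scale albert_det_albert_map flip: mult.assoc)
  ultimately have "g \<in> e6" using lin by (simp add: e6_def)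
  moreover have "induces g f"
    unfolding induces_def
  proof
    fix p
    show "\<exists>k. k \<noteq> 0 \<and> g (veronese p) = k *\<^sub>R veronese (f p)"
    proof (cases p)
      case (Affine x y)
      then show ?thesis using k by (intro exI[of _ k]) (simp add: g_def albert_map_veronese assms del: veronese.simps)
    next
      case (Slope s)
      then show ?thesis using k pos
        by (intro exI[of _ "k * \<beta>\<^sup>2"]) (simp add: g_def albert_map_veronese assms del: veronese.simps)
    next
      case Vertical
      then show ?thesis using k pos
        by (intro exI[of _ "k * (\<alpha> * \<beta>)\<^sup>2"]) (simp add: g_def albert_map_veronese assms del: veronese.simps)
    qed
  qed
  ultimately show ?thesis by blast
qed

end

text \<open>The fixed points at infinity make \<open>f\<close> permute the slopes, the vertical
  lines and the horizontal lines, which gives \<open>A\<close>, \<open>B\<close> and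
  \<open>C\<close>. The images of the remaining lines relate the three maps.\<close>

lemma stabilizer_autotopism:
  assumes f: "bij f" "\<And>l. l \<in> olines \<Longrightarrow> f ` l \<in> olines"
    and fixed: "f Vertical = Vertical" "f (Slope 0) = Slope 0" "f (Affine 0 0) = Affine 0 0"
  obtains A B C where "autotopism A B C" "\<And>p q. f (Affine p q) = Affine (B p) (C q)"
    "\<And>s. f (Slope s) = Slope (A s)"
proof -
  have mem: "f x \<in> f ` l \<longleftrightarrow> x \<in> l" for x l using f(1) by (simp add: bij_is_inj inj_image_mem_iff)
  have img: "x \<in> l \<Longrightarrow> f x = y \<Longrightarrow> y \<in> f ` l" for x y l by blast
  have inf: "f ` iline = iline"
    using f(2)[of iline] img[of Vertical iline] img[of "Slope 0" iline] fixed
    by (intro iline_unique[of _ 0]) auto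
  have mem_inf: "f x \<in> iline \<longleftrightarrow> x \<in> iline" for x using mem[of x iline] by (simp only: inf)
  have "\<exists>t. f (Slope s) = Slope t" for s
  proof -
    have "f (Slope s) \<noteq> Vertical" using fixed(1) f(1) by (metis bij_pointE plane_point.distinct(5))
    then show ?thesis using mem_inf[of "Slope s"] by (cases "f (Slope s)") auto
  qed
  then obtain A where A: "f (Slope s) = Slope (A s)" for s by metis
  have aff: "\<exists>x y. f (Affine p q) = Affine x y" for p q
    using mem_inf[of "Affine p q"] by (cases "f (Affine p q)") auto
  have vertical: "\<exists>b. m = vline b" if "m \<in> olines" "Vertical \<in> m" "Affine x y \<in> m" for m x y
    using that by (auto elim: olinesE)
  have sloped: "\<exists>d. m = oline s d" if "m \<in> olines" "Slope s \<in> m" "Affine x y \<in> m" for m s x y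
    using that(1) by (cases rule: olinesE) (use that in auto)
  have "\<exists>b. f ` vline c = vline b" for c
  proof -
    have "Vertical \<in> f ` vline c" using fixed(1) by (intro img) auto
    moreover obtain x y where "Affine x y \<in> f ` vline c"
      using aff[of c 0] img[of "Affine c 0" "vline c"] by force
    ultimately show ?thesis using f(2) vertical by blast
  qed
  then obtain B where B: "f ` vline c = vline (B c)" for c by metis
  have "\<exists>d. f ` oline 0 t = oline 0 d" for t
  proof -
    have "Slope 0 \<in> f ` oline 0 t" using fixed(2) by (intro img) auto
    moreover obtain x y where "Affine x y \<in> f ` oline 0 t"
      using aff[of 0 t] img[of "Affine 0 t" "oline 0 t"] by force
    ultimately show ?thesis using f(2) sloped by blast
  qed
  then obtain C where C: "f ` oline 0 t = oline 0 (C t)" for t by metis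
  have BC: "f (Affine p q) = Affine (B p) (C q)" for p q
  proof -
    obtain x y where xy: "f (Affine p q) = Affine x y" using aff by blast
    have "Affine x y \<in> f ` vline p" "Affine x y \<in> f ` oline 0 q"
      using img[OF _ xy] by simp_all
    then show ?thesis by (simp add: xy B C)
  qed
  have 0: "B 0 = 0" "C 0 = 0" using fixed(3) by (simp_all add: BC)
  \<comment> \<open>The image of \<open>oline s t\<close> contains \<open>Slope (A s)\<close> and
    the point (0, C t), so it is \<open>oline (A s) (C t)\<close>.\<close>
  have mult_add: "C (omult s p + t) = omult (A s) (B p) + C t" for s p t
  proof -
    have "Slope (A s) \<in> f ` oline s t" "Affine (B 0) (C t) \<in> f ` oline s t"
      using img[of "Slope s" "oline s t"] img[of "Affine 0 t" "oline s t"] by (simp_all add: A BC)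
    moreover from this obtain d where "f ` oline s t = oline (A s) d" using f(2) sloped by blast
    ultimately have "f ` oline s t = oline (A s) (C t)" by (simp add: 0)
    moreover have "Affine (B p) (C (omult s p + t)) \<in> f ` oline s t"
      by (rule img[of "Affine p (omult s p + t)"]) (simp_all add: BC)
    ultimately show ?thesis by simp
  qed
  have "A 0 = 0" using A[of 0] fixed(2) by simp
  have mult: "C (omult s p) = omult (A s) (B p)" for s p using mult_add[of s p 0] by (simp add: 0)
  have "bij A" "bij B" "bij C"
  proof -
    have inj: "f x = f y \<Longrightarrow> x = y" for x y using f(1) by (metis bij_pointE)
    have surj: "\<exists>x. f x = y" for y using f(1) by (metis bij_pointE)
    have "s = t" if "A s = A t" for s t using inj[of "Slope s" "Slope t"] that by (simp add: A)
    moreover have "\<exists>s. t = A s" for t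
    proof -
      obtain x where "f x = Slope t" using surj by blast
      then show ?thesis by (cases x) (auto simp: A BC fixed)
    qed
    ultimately show "bij A" by (metis bijI')
    have "s = t" if "B s = B t" for s t using inj[of "Affine s 0" "Affine t 0"] that by (simp add: BC)
    moreover have "\<exists>s. t = B s" for t
    proof -
      obtain x where "f x = Affine t 0" using surj by blast
      then show ?thesis by (cases x) (auto simp: A BC fixed)
    qed
    ultimately show "bij B" by (metis bijI')
    have "s = t" if "C s = C t" for s t using inj[of "Affine 0 s" "Affine 0 t"] that by (simp add: BC)
    moreover have "\<exists>s. t = C s" for t
    proof -
      obtain x where "f x = Affine 0 t" using surj by blast
      then show ?thesis by (cases x) (auto simp: A BC fixed)
    qed
    ultimately show "bij C" by (metis bijI')
  qed
  \<comment> \<open>On lines of slope one, \<open>mult_add\<close> is additivity once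
    \<open>mult\<close> replaces the product by \<open>C x\<close>.\<close>
  moreover have "C (x + y) = C x + C y" for x y
    using mult_add[of oone x y] mult[of oone x] by simp
  ultimately have "autotopism A B C" by unfold_locales (rule mult)
  then show ?thesis using that BC A by blast
qed

text \<open>The points on the sides of the coordinate triangle give eigenvectors that span the
  Albert algebra. Their eigenvalues coincide, so \<open>g\<close> is a real scalar, and preserving a
  cubic form forces its cube to be 1.\<close>

lemma induces_id_unique:
  assumes "g \<in> e6" "induces g id"
  shows "g = id"
proof -
  have lin: "linear g" using assms(1) by (simp add: e6_def)
  have ev: "\<exists>k. g (veronese p) = k *\<^sub>R veronese p" for p
    using assms(2) unfolding induces_def by (metis id_apply)
  obtain k1 where "g (veronese Vertical) = k1 *\<^sub>R veronese Vertical" using ev by blast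
  then have k1: "g (1, 0, 0, 0, 0, 0) = (k1, 0, 0, 0, 0, 0)" by simp
  obtain k2 where "g (veronese (Slope 0)) = k2 *\<^sub>R veronese (Slope 0)" using ev by blast
  then have k2: "g (0, 1, 0, 0, 0, 0) = (0, k2, 0, 0, 0, 0)" by simp
  obtain k3 where "g (veronese (Affine 0 0)) = k3 *\<^sub>R veronese (Affine 0 0)" using ev by blast
  then have k3: "g (0, 0, 1, 0, 0, 0) = (0, 0, k3, 0, 0, 0)" by (simp add: oconj_simps)
  have diag: "g (a, b, c, 0, 0, 0) = (k1 * a, k2 * b, k3 * c, 0, 0, 0)" for a b c
  proof -
    have "(a, b, c, 0, 0, 0) = a *\<^sub>R (1, 0, 0, 0, 0, 0) + b *\<^sub>R (0, 1, 0, 0, 0, 0)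
        + c *\<^sub>R (0, 0, 1, 0, 0, 0 :: octonion)" (is "?X = _") by simp
    then have "g ?X = g (a *\<^sub>R (1, 0, 0, 0, 0, 0) + b *\<^sub>R (0, 1, 0, 0, 0, 0)
        + c *\<^sub>R (0, 0, 1, 0, 0, 0))"
      by (rule arg_cong)
    then show ?thesis
      by (simp only: linear_add[OF lin] linear_scale[OF lin] k1 k2 k3) (simp add: mult.commute)
  qed
  text \<open>Comparing the eigenvectors for the points with opposite coordinates shows that the two
    eigenvalues agree with each other and with those of the diagonal.\<close>
  have X: "k = k2 \<and> k = k3" if "x \<noteq> 0" "g (veronese (Affine x 0)) = k *\<^sub>R veronese (Affine x 0)" for k x
  proof -
    obtain k' where k': "g (veronese (Affine (- x) 0)) = k' *\<^sub>R veronese (Affine (- x) 0)" using ev by blast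
    have "veronese (Affine x 0) + veronese (Affine (- x) 0) = (0, 2 * (norm x)\<^sup>2, 2, 0, 0, 0)"
      by (simp add: oconj_simps)
    then have "k *\<^sub>R veronese (Affine x 0) + k' *\<^sub>R veronese (Affine (- x) 0)
        = (0, k2 * (2 * (norm x)\<^sup>2), k3 * 2, 0, 0, 0)"
      using linear_add[OF lin, of "veronese (Affine x 0)" "veronese (Affine (- x) 0)"]
      by (simp only: that(2) k' diag mult_zero_right)
    then have "k * (norm x)\<^sup>2 + k' * (norm x)\<^sup>2 = k2 * (2 * (norm x)\<^sup>2) \<and> k + k' = k3 * 2 \<and>
        k *\<^sub>R x = k' *\<^sub>R x"
      by (simp add: oconj_simps)
    note eqs = conjunct1[OF this] conjunct1[OF conjunct2[OF this]] conjunct2[OF conjunct2[OF this]]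
    have "(k + k') * (norm x)\<^sup>2 = (2 * k2) * (norm x)\<^sup>2"
      using eqs(1) by (simp only: distrib_right mult_ac)
    then have "k + k' = 2 * k2" using that(1) by (simp only: mult_cancel_right) simp
    then show ?thesis using eqs(2,3) that(1) by simp
  qed
  have Y: "k = k1 \<and> k = k3" if "x \<noteq> 0" "g (veronese (Affine 0 x)) = k *\<^sub>R veronese (Affine 0 x)" for k x
  proof -
    obtain k' where k': "g (veronese (Affine 0 (- x))) = k' *\<^sub>R veronese (Affine 0 (- x))" using ev by blast
    have "veronese (Affine 0 x) + veronese (Affine 0 (- x)) = (2 * (norm x)\<^sup>2, 0, 2, 0, 0, 0)"
      by (simp add: oconj_simps)
    then have "k *\<^sub>R veronese (Affine 0 x) + k' *\<^sub>R veronese (Affine 0 (- x))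
        = (k1 * (2 * (norm x)\<^sup>2), 0, k3 * 2, 0, 0, 0)"
      using linear_add[OF lin, of "veronese (Affine 0 x)" "veronese (Affine 0 (- x))"]
      by (simp only: that(2) k' diag mult_zero_right)
    then have "k * (norm x)\<^sup>2 + k' * (norm x)\<^sup>2 = k1 * (2 * (norm x)\<^sup>2) \<and> k + k' = k3 * 2 \<and>
        k *\<^sub>R oconj x = k' *\<^sub>R oconj x"
      by (simp add: oconj_simps)
    note eqs = conjunct1[OF this] conjunct1[OF conjunct2[OF this]] conjunct2[OF conjunct2[OF this]]
    have "(k + k') * (norm x)\<^sup>2 = (2 * k1) * (norm x)\<^sup>2"
      using eqs(1) by (simp only: distrib_right mult_ac)
    then have "k + k' = 2 * k1" using that(1) by (simp only: mult_cancel_right) simp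
    then show ?thesis using eqs(2,3) that(1) by simp
  qed
  have Z: "k = k1 \<and> k = k2" if "x \<noteq> 0" "g (veronese (Slope x)) = k *\<^sub>R veronese (Slope x)" for k x
  proof -
    obtain k' where k': "g (veronese (Slope (- x))) = k' *\<^sub>R veronese (Slope (- x))" using ev by blast
    have "veronese (Slope x) + veronese (Slope (- x)) = (2 * (norm x)\<^sup>2, 2, 0, 0, 0, 0)"
      by (simp add: oconj_simps)
    then have "k *\<^sub>R veronese (Slope x) + k' *\<^sub>R veronese (Slope (- x))
        = (k1 * (2 * (norm x)\<^sup>2), k2 * 2, 0, 0, 0, 0)"
      using linear_add[OF lin, of "veronese (Slope x)" "veronese (Slope (- x))"]
      by (simp only: that(2) k' diag mult_zero_right)
    then have "k * (norm x)\<^sup>2 + k' * (norm x)\<^sup>2 = k1 * (2 * (norm x)\<^sup>2) \<and> k + k' = k2 * 2 \<and>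
        k *\<^sub>R x = k' *\<^sub>R x"
      by (simp add: oconj_simps)
    note eqs = conjunct1[OF this] conjunct1[OF conjunct2[OF this]] conjunct2[OF conjunct2[OF this]]
    have "(k + k') * (norm x)\<^sup>2 = (2 * k1) * (norm x)\<^sup>2"
      using eqs(1) by (simp only: distrib_right mult_ac)
    then have "k + k' = 2 * k1" using that(1) by (simp only: mult_cancel_right) simp
    then show ?thesis using eqs(2,3) that(1) by simp
  qed
  have k: "k1 = k3" "k2 = k3" using X[OF oone_neq_0] Y[OF oone_neq_0] ev by metis+
  have scale: "g (veronese p) = k3 *\<^sub>R veronese p"
    if "p = Affine x 0 \<or> p = Affine 0 x \<or> p = Slope x" for p x
    using that X[of x] Y[of x] Z[of x] ev[of p] k diag[of 0 0 1] diag[of 0 1 0]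
    by (cases "x = 0") (auto simp: oconj_simps simp del: veronese.simps, simp_all add: oconj_simps)
  note scale' = scale[OF disjI1[OF refl]] scale[OF disjI2[OF disjI1[OF refl]]]
    scale[OF disjI2[OF disjI2[OF refl]]]
  have "g X = k3 *\<^sub>R X" for X
  proof -
    obtain a b c x y z where X: "X = (a, b, c, x, y, z)" by (rule albert_cases)
    \<comment> \<open>Each octonionic entry is supplied by a point on one side of the triangle; the
      diagonal part corrects for the squared norms and for the entries 1 of these vectors.\<close>
    have "X = (a - (norm (oconj y))\<^sup>2 - (norm z)\<^sup>2, b - (norm x)\<^sup>2 - 1, c - 2, 0, 0, 0)
        + veronese (Affine x 0) + veronese (Affine 0 (oconj y)) + veronese (Slope z)"
      by (simp add: X oconj_simps)
    moreover have "g (a, b, c, 0, 0, 0) = k3 *\<^sub>R (a, b, c, 0, 0, 0)" for a b c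
      by (simp add: diag k)
    ultimately show ?thesis
      by (simp only: linear_add[OF lin] scale' scaleR_add_right)
  qed
  moreover have "k3 = 1"
  proof -
    have "albert_det (g (1, 1, 1, 0, 0, 0)) = albert_det (1, 1, 1, 0, 0, 0)"
      using assms(1) by (simp add: e6_def)
    then have "k3 ^ 3 = 1" by (simp add: diag k albert_det_inner power3_eq_cube)
    moreover have "root 3 (k3 ^ 3) = k3" by (rule odd_real_root_power_cancel) simp
    ultimately show ?thesis by simp
  qed
  ultimately show ?thesis by (simp add: fun_eq_iff)
qed

text \<open>An elementary \<open>h\<close> returns the image of the coordinate triangle to its
  place, so \<open>h \<circ> f\<close> comes from an autotopism and hence from \<open>e6\<close>.
  Composing with the inverse of the map inducing \<open>h\<close> recovers \<open>f\<close>.\<close>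

lemma collineation_induced:
  assumes f: "bij f" "\<And>l. l \<in> olines \<Longrightarrow> f ` l \<in> olines"
  shows "\<exists>g\<in>e6. induces g f"
proof -
  have mem: "f x \<in> f ` l \<longleftrightarrow> x \<in> l" for x l using f(1) by (simp add: bij_is_inj inj_image_mem_iff)
  have neq: "f Vertical \<noteq> f (Slope 0)" using f(1) by (metis bij_pointE plane_point.distinct(5))
  \<comment> \<open>Such a line is the image of \<open>iline\<close>, and injectivity of
    \<open>f\<close> keeps the image of the origin off it.\<close>
  have "f (Affine 0 0) \<notin> l" if "l \<in> olines" "f Vertical \<in> l" "f (Slope 0) \<in> l" for l
  proof -
    have "f ` iline \<in> olines" "f Vertical \<in> f ` iline" "f (Slope 0) \<in> f ` iline"
      using f(2) by (blast, simp_all)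
    then have "l = f ` iline" using that neq line_unique by blast
    then show ?thesis by (simp add: mem)
  qed
  then obtain h where h: "realizable h" "h (f Vertical) = Vertical" "h (f (Slope 0)) = Slope 0"
      "h (f (Affine 0 0)) = Affine 0 0"
    using realizable_triangle[OF neq] by blast
  then obtain g where g: "g \<in> e6" "induces g h" and lh: "line_preserving h" by (auto simp: realizable_def)
  have "bij (h \<circ> f)" using f(1) lh by (simp add: bij_comp line_preserving_def)
  moreover have "(h \<circ> f) ` l \<in> olines" if "l \<in> olines" for l
  proof -
    have "h ` f ` l \<in> olines" using f(2)[OF that] lh by (simp add: line_preserving_def)
    then show ?thesis by (simp only: image_comp)
  qed
  ultimately obtain A B C where ABC: "autotopism A B C"
      "\<And>p q. (h \<circ> f) (Affine p q) = Affine (B p) (C q)" "\<And>s. (h \<circ> f) (Slope s) = Slope (A s)"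
    by (rule stabilizer_autotopism) (simp_all add: h)
  then obtain g' where g': "g' \<in> e6" "induces g' (h \<circ> f)"
    using autotopism.induced_e6[OF ABC(1), of "h \<circ> f"] h(2) by auto
  obtain h' where h': "induces (inv_into UNIV g) h'" using e6_induces[OF e6_inv[OF g(1)]] by blast
  have "h' \<circ> (h \<circ> f) = f" using induces_inv[OF g h'] by (simp add: fun_eq_iff)
  moreover have "linear (inv_into UNIV g)" using e6_inv[OF g(1)] by (simp add: e6_def)
  ultimately have "induces (inv_into UNIV g \<circ> g') f" using induces_o[OF g'(2) h'] by simp
  then show ?thesis using e6_o[OF e6_inv[OF g(1)] g'(1)] by blast
qed

section \<open>The isotopy between the Okubo algebra and the octonions\<close>

abbreviation sqrt3 :: complex where "sqrt3 \<equiv> complex_of_real (sqrt 3)"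

text \<open>For the idempotent \<open>e = diag (2, -1, -1)\<close> of norm one, \<open>a \<cdot> b = (e \<star> a) \<star> (b \<star> e)\<close> is an octonion
  product with unit \<open>e\<close>, and \<open>s \<star> x = (s \<star> e) \<cdot> (e \<star> x)\<close>. The coordinates below refer to a
  Cayley-Dickson basis of this product, and \<open>okubo_rot\<close> with the sixth roots of unity describes
  \<open>s \<mapsto> s \<star> e\<close> and \<open>x \<mapsto> e \<star> x\<close> in them.\<close>

definition okubo_coord :: "complex ^ 3 ^ 3 \<Rightarrow> octonion" where
  "okubo_coord A =
     ((A $ 1 $ 1 / 2 + \<i> * sqrt3 * (A $ 2 $ 2 - A $ 3 $ 3) / 6, sqrt3 * A $ 2 $ 3 / 3),
      (sqrt3 * A $ 1 $ 2 / 3, - \<i> * sqrt3 * A $ 1 $ 3 / 3))"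

definition okubo_rot :: "complex \<Rightarrow> octonion \<Rightarrow> octonion" where
  "okubo_rot c z = (qconj (fst z), (c * fst (snd z), c * snd (snd z)))"

definition sixth_root :: complex where
  "sixth_root = (1 - \<i> * sqrt3) / 2"

lemma sqrt3_sq: "sqrt3 * sqrt3 = 3"
  by (metis abs_numeral of_real_mult of_real_numeral real_sqrt_mult_self)

lemma mat_mult_entry: "(mat c ** A) $ i $ j = c * A $ i $ j" for c :: complex and A :: "complex ^ 3 ^ 3"
  by (simp add: matrix_matrix_mult_def mat_def if_distrib if_distribR sum.delta cong: if_cong)

lemma okubo_mult_entry:
  "(x \<star> y) $ i $ j = okubo_mu * (\<Sum>k\<in>UNIV. x $ i $ k * y $ k $ j)
     + cnj okubo_mu * (\<Sum>k\<in>UNIV. y $ i $ k * x $ k $ j)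
     - (if i = j then (\<Sum>i\<in>UNIV. \<Sum>k\<in>UNIV. x $ i $ k * y $ k $ i) / 3 else 0)"
  by (simp only: okubo_mult_def vector_add_component vector_minus_component mat_mult_entry)
    (simp add: matrix_matrix_mult_def mat_def trace_def)

lemma okubo_entries:
  assumes "A \<in> okubo"
  shows "A $ 2 $ 1 = cnj (A $ 1 $ 2)" "A $ 3 $ 1 = cnj (A $ 1 $ 3)" "A $ 3 $ 2 = cnj (A $ 2 $ 3)"
    "A $ 1 $ 1 = - A $ 2 $ 2 - A $ 3 $ 3" "cnj (A $ 2 $ 2) = A $ 2 $ 2" "cnj (A $ 3 $ 3) = A $ 3 $ 3"
proof -
  have h: "A $ i $ j = cnj (A $ j $ i)" for i j using assms unfolding okubo_def by blast
  show "A $ 2 $ 1 = cnj (A $ 1 $ 2)" "A $ 3 $ 1 = cnj (A $ 1 $ 3)" "A $ 3 $ 2 = cnj (A $ 2 $ 3)"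
    "cnj (A $ 2 $ 2) = A $ 2 $ 2" "cnj (A $ 3 $ 3) = A $ 3 $ 3"
    by (fact h h[symmetric])+
  have "A $ 1 $ 1 + A $ 2 $ 2 + A $ 3 $ 3 = 0" using assms unfolding okubo_def trace_def sum_3 by blast
  then show "A $ 1 $ 1 = - A $ 2 $ 2 - A $ 3 $ 3" by algebra
qed

text \<open>The four complex coordinates are compared after the Hermitian and trace conditions have
  eliminated the dependent entries. The root of 3 enters as a self-conjugate \<open>k\<close> with
  square 3.\<close>

lemma okubo_isotopy:
  assumes "s \<in> okubo" "x \<in> okubo"
  shows "okubo_coord (s \<star> x) =
    omult (okubo_rot sixth_root (okubo_coord s)) (okubo_rot (cnj sixth_root) (okubo_coord x))"
proof -
  define k where "k = sqrt3"
  have k: "k * k = 3" "cnj k = k" "sqrt3 = k" using sqrt3_sq by (simp_all add: k_def)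
  have left: "k * (k * a) = 3 * a" "\<i> * (\<i> * a) = - a" for a
    using k(1) by (metis mult.assoc, simp flip: mult.assoc)
  have mu: "okubo_mu = (3 + \<i> * k) / 6" "cnj okubo_mu = (3 - \<i> * k) / 6" "sixth_root = (1 - \<i> * k) / 2"
    by (simp_all add: okubo_mu_def sixth_root_def k_def)
  have comp: "z = w" if "fst (fst z) = fst (fst w)" "snd (fst z) = snd (fst w)"
      "fst (snd z) = fst (snd w)" "snd (snd z) = snd (snd w)" for z w :: octonion
    using that by (simp add: prod_eq_iff)
  note defs = okubo_coord_def okubo_rot_def omult_def qmult_def qconj_def okubo_mult_entry sum_3 mu
    okubo_entries[OF assms(1)] okubo_entries[OF assms(2)] k
  show ?thesis
    by (rule comp; simp add: defs; simp add: field_simps left)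
qed

lemma okubo_coord_add: "okubo_coord (x + y) = okubo_coord x + okubo_coord y"
  by (simp add: okubo_coord_def add_divide_distrib diff_divide_distrib ring_distribs)

lemma okubo_add_closed: "x \<in> okubo \<Longrightarrow> y \<in> okubo \<Longrightarrow> x + y \<in> okubo"
  unfolding okubo_def mem_Collect_eq vector_add_component complex_cnj_add trace_add
  by (intro conjI allI) (metis, simp)

lemma okubo_coord_bij: "bij_betw okubo_coord okubo UNIV"
proof -
  \<comment> \<open>\<open>M\<close> solves the coordinates for the matrix: \<open>t\<close> is half
    of the first diagonal entry and \<open>r\<close> half the difference of the other two.\<close>
  define M :: "octonion \<Rightarrow> complex ^ 3 ^ 3" where
    "M z = (let t = complex_of_real (Re (fst (fst z))); r = complex_of_real (sqrt 3 * Im (fst (fst z)));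
       u = sqrt3 * fst (snd z); v = \<i> * sqrt3 * snd (snd z); w = sqrt3 * snd (fst z)
     in vector [vector [2 * t, u, v], vector [cnj u, - t + r, w], vector [cnj v, cnj w, - t - r]])" for z
  have M: "M z \<in> okubo" for z
    by (auto simp: okubo_def M_def Let_def trace_def sum_3 forall_3)
  have CM: "okubo_coord (M z) = z" for z
    by (auto simp: okubo_coord_def M_def Let_def prod_eq_iff complex_eq_iff)
  have MC: "M (okubo_coord A) = A" if "A \<in> okubo" for A
  proof -
    note e = okubo_entries[OF that]
    have im: "Im (A $ 2 $ 2) = 0" "Im (A $ 3 $ 3) = 0" using e(5,6) by (auto simp: complex_eq_iff)
    have s3: "sqrt 3 * (sqrt 3 * a) = 3 * a" for a by (simp flip: mult.assoc)
    show ?thesis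
      unfolding vec_eq_iff forall_3
      by (simp add: okubo_coord_def M_def Let_def e im s3 complex_eq_iff) (simp add: field_simps)
  qed
  show ?thesis
    by (rule bij_betw_byWitness[where f' = M]) (auto simp: M CM MC)
qed

lemma sixth_root_cnj: "sixth_root * cnj sixth_root = 1"
  using sqrt3_sq by (simp add: sixth_root_def field_simps)

lemma okubo_rot_bij:
  assumes "c * cnj c = 1"
  shows "bij (okubo_rot c)"
proof (rule o_bij)
  have c: "c * (cnj c * a) = a" "cnj c * (c * a) = a" for a
    using assms by (metis mult.assoc mult.commute mult_1)+
  show "okubo_rot (cnj c) \<circ> okubo_rot c = id" "okubo_rot c \<circ> okubo_rot (cnj c) = id"
    by (simp_all add: fun_eq_iff prod_eq_iff okubo_rot_def qconj_def c)
qed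

definition okubo_left :: "complex ^ 3 ^ 3 \<Rightarrow> octonion" where
  "okubo_left = okubo_rot sixth_root \<circ> okubo_coord"

definition okubo_right :: "complex ^ 3 ^ 3 \<Rightarrow> octonion" where
  "okubo_right = okubo_rot (cnj sixth_root) \<circ> okubo_coord"

lemma okubo_left_right_bij:
  "bij_betw okubo_left okubo UNIV" "bij_betw okubo_right okubo UNIV"
  unfolding okubo_left_def okubo_right_def
  by (rule bij_betw_trans[OF okubo_coord_bij okubo_rot_bij]; simp add: sixth_root_cnj mult.commute)+

lemma okubo_coord_surj:
  "\<exists>x\<in>okubo. okubo_left x = z" "\<exists>x\<in>okubo. okubo_right x = z" "\<exists>x\<in>okubo. okubo_coord x = z"
  using okubo_coord_bij okubo_left_right_bij unfolding bij_betw_def by (metis UNIV_I imageE)+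

section \<open>Transport of the Okubic plane to the octonionic plane\<close>

fun okubo_to_octonion :: "okubic_point \<Rightarrow> octonion plane_point" where
  "okubo_to_octonion (Affine x y) = Affine (okubo_right x) (okubo_coord y)"
| "okubo_to_octonion (Slope s) = Slope (okubo_left s)"
| "okubo_to_octonion Vertical = Vertical"

lemma okubic_points_iff:
  "Affine x y \<in> okubic_points \<longleftrightarrow> x \<in> okubo \<and> y \<in> okubo"
  "Slope s \<in> okubic_points \<longleftrightarrow> s \<in> okubo" "Vertical \<in> okubic_points"
  by (auto simp: okubic_points_def)

lemma okubo_to_octonion_bij: "bij_betw okubo_to_octonion okubic_points UNIV"
proof (rule bij_betw_imageI)
  note b = okubo_coord_bij okubo_left_right_bij
  note inj = b[THEN bij_betw_imp_inj_on, THEN inj_on_eq_iff]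
  show "inj_on okubo_to_octonion okubic_points"
  proof (rule inj_onI)
    fix p q
    show "p \<in> okubic_points \<Longrightarrow> q \<in> okubic_points \<Longrightarrow>
        okubo_to_octonion p = okubo_to_octonion q \<Longrightarrow> p = q"
      by (cases p; cases q) (simp_all add: okubic_points_iff inj)
  qed
  have "p \<in> okubo_to_octonion ` okubic_points" for p
  proof (cases p)
    case (Affine x y)
    obtain x' y' where "x' \<in> okubo" "okubo_right x' = x" "y' \<in> okubo" "okubo_coord y' = y"
      using okubo_coord_surj by metis
    then show ?thesis
      by (intro image_eqI[of _ _ "Affine x' y'"]) (simp_all add: Affine okubic_points_iff)
  next
    case (Slope s)
    obtain s' where "s' \<in> okubo" "okubo_left s' = s"
      using okubo_coord_surj by metis
    then show ?thesis
      by (intro image_eqI[of _ _ "Slope s'"]) (simp_all add: Slope okubic_points_iff)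
  next
    case Vertical
    show ?thesis
      by (intro image_eqI[of _ _ Vertical]) (simp_all add: Vertical okubic_points_iff)
  qed
  then show "okubo_to_octonion ` okubic_points = UNIV" by blast
qed

lemma image_slope_line:
  assumes "s \<in> okubo" "t \<in> okubo"
  shows "okubo_to_octonion ` slope_line s t = oline (okubo_left s) (okubo_coord t)"
proof -
  have "okubo_to_octonion ` slope_line s t =
      (\<lambda>x. Affine (okubo_right x) (okubo_coord (s \<star> x + t))) ` okubo \<union> {Slope (okubo_left s)}"
    by (simp add: slope_line_def Setcompr_eq_image image_Un image_image)
  also have "\<dots> = (\<lambda>x. Affine (okubo_right x) (omult (okubo_left s) (okubo_right x) + okubo_coord t)) ` okubo
      \<union> {Slope (okubo_left s)}"
    using assms(1) by (simp add: okubo_coord_add okubo_isotopy okubo_left_def okubo_right_def cong: image_cong)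
  also have "\<dots> = (\<lambda>x. Affine x (omult (okubo_left s) x + okubo_coord t)) ` okubo_right ` okubo
      \<union> {Slope (okubo_left s)}"
    by (simp only: image_image)
  also have "\<dots> = oline (okubo_left s) (okubo_coord t)"
    using okubo_left_right_bij(2) by (simp add: oline_def bij_betw_imp_surj_on)
  finally show ?thesis .
qed

lemma image_vertical_line: "okubo_to_octonion ` vertical_line c = vline (okubo_right c)"
proof -
  have "okubo_to_octonion ` vertical_line c = Affine (okubo_right c) ` okubo_coord ` okubo \<union> {Vertical}"
    by (simp add: vertical_line_def Setcompr_eq_image image_Un image_image)
  then show ?thesis
    using okubo_coord_bij by (simp add: vline_def bij_betw_imp_surj_on)
qed

lemma image_line_at_infinity: "okubo_to_octonion ` line_at_infinity = iline"
proof -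
  have "okubo_to_octonion ` line_at_infinity = Slope ` okubo_left ` okubo \<union> {Vertical}"
    by (simp add: line_at_infinity_def Setcompr_eq_image image_Un image_image)
  then show ?thesis
    using okubo_left_right_bij(1) by (simp add: iline_def bij_betw_imp_surj_on)
qed

lemma image_okubic_lines: "(`) okubo_to_octonion ` okubic_lines = olines"
proof (intro subset_antisym subsetI)
  fix m assume "m \<in> (`) okubo_to_octonion ` okubic_lines"
  then obtain l where l: "l \<in> okubic_lines" and m: "m = okubo_to_octonion ` l" by blast
  consider s t where "l = slope_line s t" "s \<in> okubo" "t \<in> okubo" | c where "l = vertical_line c"
    | "l = line_at_infinity"
    using l unfolding okubic_lines_def by blast
  then show "m \<in> olines"
    by cases (auto simp: m image_slope_line image_vertical_line image_line_at_infinity)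
next
  fix m assume "m \<in> olines"
  then show "m \<in> (`) okubo_to_octonion ` okubic_lines"
  proof (cases rule: olinesE)
    case (1 s t)
    obtain s' t' where st: "s' \<in> okubo" "t' \<in> okubo" "okubo_left s' = s" "okubo_coord t' = t"
      using okubo_coord_surj by metis
    then have "m = okubo_to_octonion ` slope_line s' t'" by (simp add: 1 image_slope_line)
    moreover have "slope_line s' t' \<in> okubic_lines" using st unfolding okubic_lines_def by blast
    ultimately show ?thesis by blast
  next
    case (2 c)
    obtain c' where c: "c' \<in> okubo" "okubo_right c' = c" using okubo_coord_surj by metis
    then have "m = okubo_to_octonion ` vertical_line c'" by (simp add: 2 image_vertical_line)
    moreover have "vertical_line c' \<in> okubic_lines" using c unfolding okubic_lines_def by blast
    ultimately show ?thesis by blast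
  next
    case 3
    then have "m = okubo_to_octonion ` line_at_infinity" by (simp add: image_line_at_infinity)
    moreover have "line_at_infinity \<in> okubic_lines" unfolding okubic_lines_def by blast
    ultimately show ?thesis by blast
  qed
qed

lemma okubic_lines_subset: "l \<in> okubic_lines \<Longrightarrow> l \<subseteq> okubic_points"
  by (auto simp: okubic_lines_def slope_line_def vertical_line_def line_at_infinity_def
      okubic_points_iff okubo_add_closed okubo_mult_closed)

section \<open>The isomorphism\<close>

lemma collineation_group_UNIV_iso:
  assumes \<pi>: "bij_betw \<pi> P UNIV" and L: "(`) \<pi> ` L = L'" and sub: "\<And>l. l \<in> L \<Longrightarrow> l \<subseteq> P"
  shows "collineation_group UNIV L' \<cong> collineation_group P L"
proof -
  define \<rho> where "\<rho> = inv_into P \<pi>"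
  have \<rho>: "\<rho> y \<in> P" "\<pi> (\<rho> y) = y" for y
    using \<pi> unfolding \<rho>_def by (simp_all add: bij_betw_def inv_into_into f_inv_into_f)
  have \<rho>\<pi>: "\<rho> (\<pi> x) = x" if "x \<in> P" for x
    using \<pi> that unfolding \<rho>_def by (simp add: bij_betw_def)
  \<comment> \<open>Elements of \<open>Bij P\<close> are undefined outside \<open>P\<close>, so the
    conjugate must be restricted.\<close>
  define T where "T f = restrict (\<rho> \<circ> f \<circ> \<pi>) P" for f
  define S where "S h = \<pi> \<circ> h \<circ> \<rho>" for h
  have \<rho>_bij: "bij_betw \<rho> UNIV P" using \<pi> unfolding \<rho>_def by (rule bij_betw_inv_into)
  have \<rho>_image: "\<rho> ` \<pi> ` l = l" if "l \<subseteq> P" for l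
    using that \<rho>\<pi> by (force simp: image_iff)
  have T_Bij: "T f \<in> Bij P" if "bij f" for f
    using bij_betw_trans[OF bij_betw_trans[OF \<pi> that] \<rho>_bij]
    by (simp add: T_def Bij_def comp_assoc cong: bij_betw_cong)
  have S_Bij: "bij (S h)" if "h \<in> Bij P" for h
    using that bij_betw_trans[OF bij_betw_trans[OF \<rho>_bij, of h P] \<pi>]
    by (simp add: S_def Bij_def comp_assoc)
  have T_coll: "T f \<in> collineations P L" if f: "f \<in> collineations UNIV L'" for f
  proof -
    have "T f ` l \<in> L" if "l \<in> L" for l
    proof -
      have "\<pi> ` l \<in> L'" using that L by blast
      then have "f ` \<pi> ` l \<in> L'" using f by (simp add: collineations_def)
      then obtain m where m: "m \<in> L" "f ` \<pi> ` l = \<pi> ` m" using L by blast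
      have "T f ` l = \<rho> ` f ` \<pi> ` l" using sub[OF that] by (force simp: T_def image_iff)
      then show ?thesis using m sub \<rho>_image by simp
    qed
    then show ?thesis using f T_Bij by (simp add: collineations_def Bij_def)
  qed
  have S_coll: "S h \<in> collineations UNIV L'" if h: "h \<in> collineations P L" for h
  proof -
    have "S h ` l \<in> L'" if l: "l \<in> L'" for l
    proof -
      obtain m where m: "m \<in> L" "l = \<pi> ` m" using l L by blast
      have "S h ` l = \<pi> ` h ` \<rho> ` \<pi> ` m" by (simp add: S_def m image_comp)
      also have "\<dots> = \<pi> ` h ` m" using m sub \<rho>_image by simp
      finally show ?thesis using h m L by (auto simp: collineations_def)
    qed
    then show ?thesis using h S_Bij by (simp add: collineations_def Bij_def)
  qed
  have ST: "S (T f) = f" for f by (simp add: S_def T_def \<rho> fun_eq_iff)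
  have TS: "T (S h) = h" if "h \<in> collineations P L" for h
  proof
    fix x
    have h: "h \<in> extensional P" "bij_betw h P P"
      using that unfolding collineations_def Bij_def by blast+
    show "T (S h) x = h x"
    proof (cases "x \<in> P")
      case True
      then have "h x \<in> P" using h(2) by (rule bij_betw_apply[rotated])
      then show ?thesis using True by (simp add: T_def S_def \<rho>\<pi>)
    next
      case False
      then show ?thesis by (simp add: T_def extensional_arb[OF h(1)])
    qed
  qed
  have "T \<in> iso (collineation_group UNIV L') (collineation_group P L)"
  proof (rule isoI)
    show "T \<in> hom (collineation_group UNIV L') (collineation_group P L)"
    proof (rule homI)
      fix f h assume f: "f \<in> carrier (collineation_group UNIV L')" "h \<in> carrier (collineation_group UNIV L')"
      then show "T f \<in> carrier (collineation_group P L)" by (simp add: collineation_group_def T_coll)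
      have fh: "f \<in> Bij UNIV" "h \<in> Bij UNIV" "T f \<in> Bij P" "T h \<in> Bij P"
        using f T_Bij by (auto simp: collineation_group_def collineations_def Bij_def)
      have "compose P (T f) (T h) = T (compose UNIV f h)"
        by (auto simp: compose_def T_def \<rho> restrict_def fun_eq_iff)
      then show "T (f \<otimes>\<^bsub>collineation_group UNIV L'\<^esub> h) = T f \<otimes>\<^bsub>collineation_group P L\<^esub> T h"
        using fh by (simp add: collineation_group_def BijGroup_def)
    qed
    show "bij_betw T (carrier (collineation_group UNIV L')) (carrier (collineation_group P L))"
      by (rule bij_betw_byWitness[where f' = S])
        (auto simp: collineation_group_def ST TS T_coll S_coll)
  qed
  then show ?thesis by (rule is_isoI)
qed

text \<open>Uniqueness of the induced map makes the assignment multiplicative. Injectivity is the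
  triviality of the kernel, \<open>induces_id_unique\<close>, and surjectivity is
  \<open>collineation_induced\<close>.\<close>

lemma E6_iso_octonionic: "E6_minus26 \<cong> collineation_group UNIV olines"
proof -
  define \<Psi> where "\<Psi> g = (THE f. induces g f)" for g
  have \<Psi>: "induces g (\<Psi> g)" if "g \<in> e6" for g
    unfolding \<Psi>_def using e6_induces[OF that] induces_unique by (metis theI)
  have \<Psi>_eq: "\<Psi> g = f" if "induces g f" for g f
    unfolding \<Psi>_def using that induces_unique by (metis the_equality)
  have carrier: "carrier E6_minus26 = e6"
    by (auto simp: E6_minus26_def e6_def Bij_def)
  have coll: "f \<in> collineations UNIV olines \<longleftrightarrow> bij f \<and> (\<forall>l\<in>olines. f ` l \<in> olines)" for f
    by (auto simp: collineations_def Bij_def)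
  have \<Psi>_coll: "\<Psi> g \<in> collineations UNIV olines" if "g \<in> e6" for g
    using that \<Psi> induces_bij induces_image_line unfolding coll by blast
  have "\<Psi> \<in> iso E6_minus26 (collineation_group UNIV olines)"
  proof (rule isoI)
    show "\<Psi> \<in> hom E6_minus26 (collineation_group UNIV olines)"
    proof (rule homI; unfold carrier)
      fix g h assume g: "g \<in> e6" "h \<in> e6"
      then show "\<Psi> g \<in> carrier (collineation_group UNIV olines)"
        by (simp add: collineation_group_def \<Psi>_coll)
      have B: "g \<in> Bij UNIV" "h \<in> Bij UNIV" "\<Psi> g \<in> Bij UNIV" "\<Psi> h \<in> Bij UNIV"
        using g \<Psi>_coll by (auto simp: Bij_def e6_def collineations_def)
      have "linear g" using g by (simp add: e6_def)
      then have "\<Psi> (g \<circ> h) = \<Psi> g \<circ> \<Psi> h" using g \<Psi> by (intro \<Psi>_eq induces_o) auto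
      then show "\<Psi> (g \<otimes>\<^bsub>E6_minus26\<^esub> h) = \<Psi> g \<otimes>\<^bsub>collineation_group UNIV olines\<^esub> \<Psi> h"
        using B by (simp add: E6_minus26_def collineation_group_def BijGroup_def compose_def
            restrict_def comp_def)
    qed
    show "bij_betw \<Psi> (carrier E6_minus26) (carrier (collineation_group UNIV olines))"
    proof (rule bij_betw_imageI)
      show "inj_on \<Psi> (carrier E6_minus26)"
      proof (rule inj_onI; unfold carrier)
        fix g h assume g: "g \<in> e6" "h \<in> e6" and eq: "\<Psi> g = \<Psi> h"
        let ?h = "inv_into UNIV h"
        have h: "?h \<in> e6" "bij h" "linear ?h" using g(2) e6_inv[OF g(2)] by (simp_all add: e6_def)
        obtain k where k: "induces ?h k" using e6_induces[OF h(1)] by blast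
        \<comment> \<open>As \<open>\<Psi> g = \<Psi> h\<close>, the point map \<open>k\<close> of
          the inverse of \<open>h\<close> also undoes \<open>\<Psi> g\<close>.\<close>
        have "k \<circ> \<Psi> g = id" using induces_inv(2)[OF g(2) \<Psi>[OF g(2)] k] by (simp add: eq fun_eq_iff)
        then have "induces (?h \<circ> g) id" using induces_o[OF \<Psi>[OF g(1)] k h(3)] by simp
        then have "?h \<circ> g = id" using induces_id_unique e6_o[OF h(1) g(1)] by blast
        then have "inv_into UNIV h (g X) = X" for X by (simp add: fun_eq_iff)
        then show "g = h" using h(2) by (metis bij_is_surj surj_f_inv_f ext)
      qed
      have "f \<in> \<Psi> ` e6" if f: "f \<in> collineations UNIV olines" for f
      proof -
        obtain g where "g \<in> e6" "induces g f" using f collineation_induced unfolding coll by blast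
        then show ?thesis using \<Psi>_eq by blast
      qed
      then show "\<Psi> ` carrier E6_minus26 = carrier (collineation_group UNIV olines)"
        using \<Psi>_coll by (auto simp: carrier collineation_group_def)
    qed
  qed
  then show ?thesis by (rule is_isoI)
qed

theorem corollary26:
  shows "collineation_group okubic_points okubic_lines \<cong> E6_minus26"
proof (rule group.iso_sym[OF group_E6_minus26])
  \<comment> \<open>The chain starts at \<open>E6_minus26\<close> because reversing an isomorphism
    requires its source to be a group, which is known there.\<close>
  note E6_iso_octonionic
  also have "collineation_group UNIV olines \<cong> collineation_group okubic_points okubic_lines"
    using okubo_to_octonion_bij image_okubic_lines okubic_lines_subset
    by (rule collineation_group_UNIV_iso)
  finally show "E6_minus26 \<cong> collineation_group okubic_points okubic_lines" .
qed

end
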